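(* Assume that: (a) $\xi=g(S_T)$ where $g$ is continuous with values in $\mathbb R^d_+$, and $\xi$ is hedgeable; (b) for each $t\le T-1$, $\operatorname{supp}_{\mathcal F_t}S_{t+1}=\phi_t(S_t)$, where $\phi_t$ is a lower hemicontinuous set-valued function on $\mathbb R^m$ with compact values such that $\phi_t(S_t)\subseteq\bar B(0,R_t(S_t))$ for a continuous function $R_t$ on $\mathbb R^m$. Suppose that the cost functions are normal integrands, are either super-additive or sub-additive in their second variable, and are positively super $\delta$-homogeneous. Then, under the condition SAIP, for each $t\le T$ there exists an $\mathcal F_t$-normal integrand $\tilde\gamma_t^{\xi}$ on $\Omega\times\mathbb R^m\times\mathbb R^d$ such that, for all $V_{t-1}\in L^0(\mathbb R^d,\mathcal F_{t-1})$, $\gamma_t^{\xi}(V_{t-1})=\tilde\gamma_t^{\xi}(S_t,V_{t-1})$ a.s. Moreover, these can be computed $\omega$-wise: for $t\le T-1$, $$\tilde\gamma_t^{\xi}(S_t,V_{t-1})=\inf_{y\in\mathbb R^d}\Big(C_t\big(S_t,(0,y^{(2)}-V_{t-1}^{(2)})\big)+\sup_{s\in\phi_t(S_t)}\tilde\gamma_{t+1}^{\xi}(s,y)\Big)\quad\text{a.s.}$$ Also, the infimum hedging cost of $\xi$ at any time $t$ is reached, i.e. $\gamma_t^{\xi}(V_{t-1})$ is a minimal cost: there is $V^{(2)}\in\Pi_t^T(V_{t-1},\xi)$ attaining the essential infimum that defines $\gamma_t^{\xi}(V_{t-1})$.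
   Context: Setting. $(\Omega,(\mathcal F_t)_{t=0}^T,P)$ is a discrete-time stochastic basis with complete filtration ($\mathcal F_0$ contains the $P$-null sets); $\mathcal F_{-1}:=\mathcal F_0$. For a (random) set $A\subseteq\mathbb R^k$, $L^0(A,\mathcal F_t)$ is the set of (classes of) $\mathcal F_t$-measurable random variables $X$ with $X\in A$ a.s. For $z\in\mathbb R^d$ write $z=(z^1,z^{(2)})$ with $z^{(2)}=(z^2,\dots,z^d)$, and $e_1=(1,0,\dots,0)$. $\bar B(0,r)$ is the closed ball. For a family of random variables, $\operatorname{ess\,sup}_{\mathcal F_t}$ (resp. $\operatorname{ess\,inf}_{\mathcal F_t}$) is the smallest (resp. largest) $\mathcal F_t$-measurable $[-\infty,\infty]$-valued random variable which a.s. dominates (resp. is a.s. dominated by) every member; for a single random variable $X$ it is that of $\{X\}$. An $\mathcal F$-normal integrand is an (extended real-valued) function $f(\omega,x)$ on $\Omega\times\mathbb R^k$ that is $\mathcal F\otimes\mathcal B(\mathbb R^k)$-measurable and lower semicontinuous in $x$. $\operatorname{supp}_{\mathcal F_t}S_{t+1}$ (conditional support) is the smallest $\mathcal F_t$-measurable random closed set containing $S_{t+1}$ a.s. Market. $S_t$ is an $\mathcal F_t$-measurable $\mathbb R^m_+$-valued random variable ($m\ge d\ge 1$). For $t\le T$ the cost function $C_t:\mathbb R^m\times\mathbb R^d\to\mathbb R$ is Borel and lower semicontinuous and satisfies: $C_t(s,0)=0$ for $s\in\mathbb R^m_+$; $C_t(s,x+\lambda e_1)=C_t(s,x)+\lambda$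 for $\lambda\in\mathbb R$; $C_T(s,x_2)\ge C_T(s,x_1)$ whenever $x_2-x_1\in\mathbb R^d_+$; $|C_t(s,x)|\le h_t(s,x)$ for a deterministic continuous function $h_t$. One writes $C_t(x)=C_t(S_t,x)$. The solvency sets are $G_t=\{z\in\mathbb R^d: -C_t(-z)\ge 0\}$; they are closed, graph-measurable w.r.t. $\mathcal F_t$, satisfy $G_t+\mathbb R^d_+\subseteq G_t$, $-e_1\notin G_t$, and $C_t(z)=\min\{\alpha\in\mathbb R:\alpha e_1-z\in G_t\}$. A portfolio process is an adapted $\mathbb R^d$-valued process $V$ with $V_{-1}\in\mathbb R e_1$ and $V_t-V_{t-1}\in -G_t$ a.s. for $t=0,\dots,T$. The payoff $\xi$ is hedgeable if there is a portfolio process $V^\xi$ with $V_T^\xi=\xi$. Super $\delta$-homogeneity: $\delta$ is an increasing bijection of $[0,+\infty]$ with $\delta(0)=0$, $\delta(\infty)=\infty$, and $C$ is positively super $\delta$-homogeneous if, for every $t\le T$, $C_t(s,\lambda x)\ge\delta(\lambda)C_t(s,x)$ for all $\lambda\ge1$, $s\in\mathbb R^m_+$, $x\in\mathbb R^d$. Hedging costs. For $\xi\in L^0(\mathbb R^d,\mathcal F_T)$, $0\le t\le T$ and $V_{t-1}\in L^0(\mathbb R^d,\mathcal F_t)$, $$\gamma_t^{\xi}(V_{t-1}):=\operatorname*{ess\,inf}_{V^{(2)}\in\Pi_t^T(V_{t-1},\xi)}{}_{\mathcal F_t}\ \operatorname{ess\,sup}_{\mathcal F_t}\Big(\xi^1+\sum_{s=t}^T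 C_s\big(0,V_s^{(2)}-V_{s-1}^{(2)}\big)\Big),$$ where $\Pi_t^T(V_{t-1},\xi)$ is the set of families $(V_s^{(2)})_{s=t-1}^T$ whose entry at $t-1$ is the given $V_{t-1}^{(2)}$, with $V_s^{(2)}\in L^0(\mathbb R^{d-1},\mathcal F_s)$ for $s=t,\dots,T-1$ and $V_T^{(2)}=\xi^{(2)}$. For $t\le T-1$, $\theta_t^\xi(V_t):=\operatorname{ess\,sup}_{\mathcal F_t}\gamma_{t+1}^\xi(V_t)$ and $D_t^\xi(S_t,V_{t-1},V_t):=C_t(S_t,(0,V_t^{(2)}-V_{t-1}^{(2)}))+\theta_t^\xi(V_t)$. Superscript $0$ means payoff $\xi=0$. AIP holds at time $t$ if $\gamma_t^0(0)=0$. SAIP holds at time $t$ if AIP holds at time $t$ and, for any $Z_t\in L^0(\mathbb R^d,\mathcal F_t)$, $D_t^0(S_t,0,Z_t)=0$ a.s. if and only if $Z_t^{(2)}=0$ a.s. AIP (resp. SAIP) holds if it holds at every time; requirements on $D_t^0$ concern $t\le T-1$. *)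

theory Defs
  imports "HOL-Probability.Probability"
begin

section \<open>Semicontinuity, normal integrands, random sets, essential bounds\<close>

definition lsc :: "('x::topological_space \<Rightarrow> ereal) \<Rightarrow> bool" where
  "lsc f \<longleftrightarrow> (\<forall>x. f x \<le> Liminf (at x) f)"

definition normal_integrand ::
    "'w measure \<Rightarrow> ('w \<Rightarrow> 'x::topological_space \<Rightarrow> ereal) \<Rightarrow> bool" where
  "normal_integrand N f \<longleftrightarrow>
     (\<lambda>(\<omega>, x). f \<omega> x) \<in> borel_measurable (N \<Otimes>\<^sub>M borel) \<and> (\<forall>\<omega>\<in>space N. lsc (f \<omega>))"

definition lower_hemicontinuous ::
    "('a::topological_space \<Rightarrow> 'b::topological_space set) \<Rightarrow> bool" where
  "lower_hemicontinuous \<phi> \<longleftrightarrow> (\<forall>U. open U \<longrightarrow> open {x. \<phi> x \<inter> U \<noteq> {}})"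

text \<open>Measurability of a random closed set is in the sense of Effros.\<close>

definition random_closed_set ::
    "'w measure \<Rightarrow> ('w \<Rightarrow> 'x::topological_space set) \<Rightarrow> bool" where
  "random_closed_set N \<Gamma> \<longleftrightarrow>
     (\<forall>\<omega>\<in>space N. closed (\<Gamma> \<omega>)) \<and>
     (\<forall>U. open U \<longrightarrow> {\<omega> \<in> space N. \<Gamma> \<omega> \<inter> U \<noteq> {}} \<in> sets N)"

text \<open>\<open>\<Gamma>\<close> is a version of the conditional support of \<open>X\<close> given the sub-sigma-algebra \<open>N\<close>
  (it is unique only up to almost sure equality).\<close>

definition is_cond_supp ::
    "'w measure \<Rightarrow> 'w measure \<Rightarrow> ('w \<Rightarrow> 'x::topological_space) \<Rightarrow> ('w \<Rightarrow> 'x set) \<Rightarrow> bool" where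
  "is_cond_supp M N X \<Gamma> \<longleftrightarrow>
     random_closed_set N \<Gamma> \<and> (AE \<omega> in M. X \<omega> \<in> \<Gamma> \<omega>) \<and>
     (\<forall>\<Gamma>'. random_closed_set N \<Gamma>' \<and> (AE \<omega> in M. X \<omega> \<in> \<Gamma>' \<omega>)
            \<longrightarrow> (AE \<omega> in M. \<Gamma> \<omega> \<subseteq> \<Gamma>' \<omega>))"

text \<open>Essential bounds of a family given a sub-sigma-algebra \<open>N\<close> of \<open>M\<close> are determined only up to
  almost sure equality; \<open>ess_sup\<close> and \<open>ess_inf\<close> pick some version.\<close>

definition is_ess_sup ::
    "'w measure \<Rightarrow> 'w measure \<Rightarrow> ('w \<Rightarrow> ereal) set \<Rightarrow> ('w \<Rightarrow> ereal) \<Rightarrow> bool" where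
  "is_ess_sup M N A Z \<longleftrightarrow>
     Z \<in> borel_measurable N \<and> (\<forall>X\<in>A. AE \<omega> in M. X \<omega> \<le> Z \<omega>) \<and>
     (\<forall>Y\<in>borel_measurable N. (\<forall>X\<in>A. AE \<omega> in M. X \<omega> \<le> Y \<omega>) \<longrightarrow> (AE \<omega> in M. Z \<omega> \<le> Y \<omega>))"

definition is_ess_inf ::
    "'w measure \<Rightarrow> 'w measure \<Rightarrow> ('w \<Rightarrow> ereal) set \<Rightarrow> ('w \<Rightarrow> ereal) \<Rightarrow> bool" where
  "is_ess_inf M N A Z \<longleftrightarrow>
     Z \<in> borel_measurable N \<and> (\<forall>X\<in>A. AE \<omega> in M. Z \<omega> \<le> X \<omega>) \<and>
     (\<forall>Y\<in>borel_measurable N. (\<forall>X\<in>A. AE \<omega> in M. Y \<omega> \<le> X \<omega>) \<longrightarrow> (AE \<omega> in M. Y \<omega> \<le> Z \<omega>))"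

definition ess_sup :: "'w measure \<Rightarrow> 'w measure \<Rightarrow> ('w \<Rightarrow> ereal) set \<Rightarrow> 'w \<Rightarrow> ereal" where
  "ess_sup M N A = (SOME Z. is_ess_sup M N A Z)"

definition ess_inf :: "'w measure \<Rightarrow> 'w measure \<Rightarrow> ('w \<Rightarrow> ereal) set \<Rightarrow> 'w \<Rightarrow> ereal" where
  "ess_inf M N A = (SOME Z. is_ess_inf M N A Z)"


section \<open>The market\<close>

text \<open>The space of positions is \<open>real ^ 'd\<close> with a distinguished cash coordinate \<open>k\<close>, which plays
  the role of the first coordinate. The non-cash part \<open>z2\<close> of a position, an element of a
  space of dimension \<open>d - 1\<close>, is identified with \<open>(0, z2)\<close>, i.e. with a vector whose
  \<open>k\<close>-coordinate vanishes; this also covers \<open>d = 1\<close>. The order on vectors is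
  componentwise, so \<open>0 \<le> z\<close> says that \<open>z\<close> lies in the nonnegative orthant.\<close>

abbreviation cash :: "'d::finite \<Rightarrow> real ^ 'd" where
  "cash k \<equiv> axis k 1"

definition risky :: "'d::finite \<Rightarrow> real ^ 'd \<Rightarrow> real ^ 'd" where
  "risky k z = (\<chi> i. if i = k then 0 else z $ i)"

locale stochastic_basis = prob_space M + complete_measure M
  for M :: "'w measure" and F :: "nat \<Rightarrow> 'w measure" and T :: nat +
  assumes subalgebra_F: "t \<le> T \<Longrightarrow> subalgebra M (F t)"
    and F_mono: "s \<le> t \<Longrightarrow> t \<le> T \<Longrightarrow> sets (F s) \<subseteq> sets (F t)"
    and null_sets_F: "null_sets M \<subseteq> sets (F 0)"

definition solvency ::
    "(nat \<Rightarrow> 'w \<Rightarrow> real ^ 'm) \<Rightarrow> (nat \<Rightarrow> real ^ 'm \<Rightarrow> real ^ 'd \<Rightarrow> real) \<Rightarrow> nat \<Rightarrow> 'w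
      \<Rightarrow> (real ^ 'd) set" where
  "solvency S C t \<omega> = {z. - C t (S t \<omega>) (- z) \<ge> 0}"

text \<open>Of the standard properties of the solvency sets, only monotonicity has to be required
  (\<open>cost_mono\<close> yields it just for \<open>t = T\<close>); the others are derived below.\<close>

locale cost_market = stochastic_basis M F T
  for M :: "'w measure" and F :: "nat \<Rightarrow> 'w measure" and T :: nat +
  fixes k :: "'d::finite"
    and S :: "nat \<Rightarrow> 'w \<Rightarrow> real ^ 'm::finite"
    and C :: "nat \<Rightarrow> real ^ 'm \<Rightarrow> real ^ 'd \<Rightarrow> real"
  assumes S_measurable: "t \<le> T \<Longrightarrow> S t \<in> borel_measurable (F t)"
    and S_nonneg: "t \<le> T \<Longrightarrow> \<omega> \<in> space M \<Longrightarrow> 0 \<le> S t \<omega>"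
    and cost_borel: "t \<le> T \<Longrightarrow> (\<lambda>(s, x). C t s x) \<in> borel_measurable borel"
    and cost_lsc: "t \<le> T \<Longrightarrow> lsc (\<lambda>(s, x). ereal (C t s x))"
    and cost_zero: "t \<le> T \<Longrightarrow> 0 \<le> s \<Longrightarrow> C t s 0 = 0"
    and cost_cash: "t \<le> T \<Longrightarrow> C t s (x + a *\<^sub>R cash k) = C t s x + a"
    and cost_mono: "0 \<le> x2 - x1 \<Longrightarrow> C T s x1 \<le> C T s x2"
    and cost_bound: "t \<le> T \<Longrightarrow>
          \<exists>h. continuous_on UNIV (\<lambda>(s, x). h s x) \<and> (\<forall>s x. \<bar>C t s x\<bar> \<le> h s x)"
    and solvency_mono: "t \<le> T \<Longrightarrow> \<omega> \<in> space M \<Longrightarrow> z \<in> solvency S C t \<omega> \<Longrightarrow> 0 \<le> y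
          \<Longrightarrow> z + y \<in> solvency S C t \<omega>"

lemma lsc_closed_le:
  assumes "lsc f"
  shows "closed {x. f x \<le> c}"
proof -
  have "open {x. c < f x}"
  proof (subst open_subopen, safe)
    fix x assume "c < f x"
    then have "c < Liminf (at x) f"
      using assms unfolding lsc_def by (auto intro: less_le_trans)
    then have "eventually (\<lambda>y. c < f y) (at x)"
      by (rule less_LiminfD)
    then obtain U where "open U" "x \<in> U" "\<forall>y\<in>U. y \<noteq> x \<longrightarrow> c < f y"
      unfolding eventually_at_topological by auto
    with \<open>c < f x\<close> show "\<exists>U. open U \<and> x \<in> U \<and> U \<subseteq> {x. c < f x}"
      by (intro exI[of _ U]) auto
  qed
  moreover have "{x. f x \<le> c} = - {x. c < f x}" by auto
  ultimately show ?thesis by (simp add: closed_def)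
qed

context cost_market
begin

lemma closed_solvency:
  assumes "t \<le> T"
  shows "closed (solvency S C t \<omega>)"
proof -
  let ?A = "{p. (case p of (s, x) \<Rightarrow> ereal (C t s x)) \<le> 0}"
  have "closed ?A" by (rule lsc_closed_le[OF cost_lsc[OF assms]])
  then have "closed ((\<lambda>z. (S t \<omega>, - z)) -` ?A)"
    by (rule closed_vimage) (intro continuous_intros)
  also have "(\<lambda>z. (S t \<omega>, - z)) -` ?A = solvency S C t \<omega>"
    by (auto simp: solvency_def)
  finally show ?thesis .
qed

lemma solvency_graph_measurable:
  assumes "t \<le> T"
  shows "{(\<omega>, z). \<omega> \<in> space (F t) \<and> z \<in> solvency S C t \<omega>} \<in> sets (F t \<Otimes>\<^sub>M borel)"
proof -
  note S_measurable[OF assms, measurable] cost_borel[OF assms, measurable]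
  have "(\<lambda>p. case (S t (fst p), - snd p) of (s, x) \<Rightarrow> C t s x) \<in> borel_measurable (F t \<Otimes>\<^sub>M borel)"
    by measurable
  then have "{p \<in> space (F t \<Otimes>\<^sub>M borel).
      (case (S t (fst p), - snd p) of (s, x) \<Rightarrow> C t s x) \<le> 0} \<in> sets (F t \<Otimes>\<^sub>M borel)"
    by measurable
  also have "{p \<in> space (F t \<Otimes>\<^sub>M borel). (case (S t (fst p), - snd p) of (s, x) \<Rightarrow> C t s x) \<le> 0}
      = {(\<omega>, z). \<omega> \<in> space (F t) \<and> z \<in> solvency S C t \<omega>}"
    by (auto simp: space_pair_measure solvency_def)
  finally show ?thesis .
qed

lemma minus_cash_not_solvent:
  assumes "t \<le> T" "\<omega> \<in> space M"
  shows "- cash k \<notin> solvency S C t \<omega>"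
  using cost_cash[OF assms(1), of "S t \<omega>" 0 1] cost_zero[OF assms(1) S_nonneg[OF assms]]
  by (simp add: solvency_def)

lemma cost_eq_least_solvent:
  assumes "t \<le> T"
  shows "C t (S t \<omega>) z \<in> {a. a *\<^sub>R cash k - z \<in> solvency S C t \<omega>}"
    and "a *\<^sub>R cash k - z \<in> solvency S C t \<omega> \<Longrightarrow> C t (S t \<omega>) z \<le> a"
  using cost_cash[OF assms, of "S t \<omega>" z "- a" for a] by (auto simp: solvency_def)

end

text \<open>Processes that start at time \<open>-1\<close> are indexed by integers; \<open>nat (- 1) = 0\<close> implements the
  convention that the sigma-algebra at time \<open>-1\<close> is the one at time \<open>0\<close>.\<close>

definition portfolio_process ::
    "'w measure \<Rightarrow> (nat \<Rightarrow> 'w measure) \<Rightarrow> nat \<Rightarrow> 'd::finite \<Rightarrow> (nat \<Rightarrow> 'w \<Rightarrow> real ^ 'm::finite)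
      \<Rightarrow> (nat \<Rightarrow> real ^ 'm \<Rightarrow> real ^ 'd \<Rightarrow> real) \<Rightarrow> (int \<Rightarrow> 'w \<Rightarrow> real ^ 'd) \<Rightarrow> bool" where
  "portfolio_process M F T k S C V \<longleftrightarrow>
     (\<forall>t\<in>{- 1..int T}. V t \<in> borel_measurable (F (nat t))) \<and>
     (AE \<omega> in M. V (- 1) \<omega> \<in> range (\<lambda>a. a *\<^sub>R cash k)) \<and>
     (\<forall>t\<le>T. AE \<omega> in M. V (int t) \<omega> - V (int t - 1) \<omega> \<in> uminus ` solvency S C t \<omega>)"

definition hedgeable ::
    "'w measure \<Rightarrow> (nat \<Rightarrow> 'w measure) \<Rightarrow> nat \<Rightarrow> 'd::finite \<Rightarrow> (nat \<Rightarrow> 'w \<Rightarrow> real ^ 'm::finite)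
      \<Rightarrow> (nat \<Rightarrow> real ^ 'm \<Rightarrow> real ^ 'd \<Rightarrow> real) \<Rightarrow> ('w \<Rightarrow> real ^ 'd) \<Rightarrow> bool" where
  "hedgeable M F T k S C \<xi> \<longleftrightarrow>
     (\<exists>V. portfolio_process M F T k S C V \<and> (AE \<omega> in M. V (int T) \<omega> = \<xi> \<omega>))"

definition super_additive :: "('a::ab_group_add \<Rightarrow> real) \<Rightarrow> bool" where
  "super_additive f \<longleftrightarrow> (\<forall>x y. f x + f y \<le> f (x + y))"

definition sub_additive :: "('a::ab_group_add \<Rightarrow> real) \<Rightarrow> bool" where
  "sub_additive f \<longleftrightarrow> (\<forall>x y. f (x + y) \<le> f x + f y)"

definition super_homogeneous ::
    "(ennreal \<Rightarrow> ennreal) \<Rightarrow> nat \<Rightarrow> (nat \<Rightarrow> real ^ 'm::finite \<Rightarrow> real ^ 'd::finite \<Rightarrow> real) \<Rightarrow> bool" where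
  "super_homogeneous \<delta> T C \<longleftrightarrow>
     mono \<delta> \<and> bij \<delta> \<and> \<delta> 0 = 0 \<and> \<delta> top = top \<and>
     (\<forall>t\<le>T. \<forall>l\<ge>1. \<forall>s\<ge>0. \<forall>x.
        enn2ereal (\<delta> (ennreal l)) * ereal (C t s x) \<le> ereal (C t s (l *\<^sub>R x)))"


section \<open>Hedging costs\<close>

definition strategies ::
    "(nat \<Rightarrow> 'w measure) \<Rightarrow> nat \<Rightarrow> 'd::finite \<Rightarrow> ('w \<Rightarrow> real ^ 'd) \<Rightarrow> nat \<Rightarrow> ('w \<Rightarrow> real ^ 'd)
      \<Rightarrow> (int \<Rightarrow> 'w \<Rightarrow> real ^ 'd) set" where
  "strategies F T k \<xi> t v =
     {V. V (int t - 1) = (\<lambda>\<omega>. risky k (v \<omega>)) \<and>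
         (\<forall>s. t \<le> s \<and> s < T \<longrightarrow>
            V (int s) \<in> borel_measurable (F s) \<and> (\<forall>\<omega>. V (int s) \<omega> $ k = 0)) \<and>
         V (int T) = (\<lambda>\<omega>. risky k (\<xi> \<omega>))}"

definition strategy_cost ::
    "nat \<Rightarrow> 'd::finite \<Rightarrow> (nat \<Rightarrow> 'w \<Rightarrow> real ^ 'm::finite) \<Rightarrow> (nat \<Rightarrow> real ^ 'm \<Rightarrow> real ^ 'd \<Rightarrow> real)
      \<Rightarrow> ('w \<Rightarrow> real ^ 'd) \<Rightarrow> nat \<Rightarrow> (int \<Rightarrow> 'w \<Rightarrow> real ^ 'd) \<Rightarrow> 'w \<Rightarrow> ereal" where
  "strategy_cost T k S C \<xi> t V \<omega> =
     ereal (\<xi> \<omega> $ k + (\<Sum>s=t..T. C s (S s \<omega>) (V (int s) \<omega> - V (int s - 1) \<omega>)))"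

definition hedging_cost ::
    "'w measure \<Rightarrow> (nat \<Rightarrow> 'w measure) \<Rightarrow> nat \<Rightarrow> 'd::finite \<Rightarrow> (nat \<Rightarrow> 'w \<Rightarrow> real ^ 'm::finite)
      \<Rightarrow> (nat \<Rightarrow> real ^ 'm \<Rightarrow> real ^ 'd \<Rightarrow> real) \<Rightarrow> ('w \<Rightarrow> real ^ 'd) \<Rightarrow> nat
      \<Rightarrow> ('w \<Rightarrow> real ^ 'd) \<Rightarrow> 'w \<Rightarrow> ereal" where
  "hedging_cost M F T k S C \<xi> t v =
     ess_inf M (F t) ((\<lambda>V. ess_sup M (F t) {strategy_cost T k S C \<xi> t V}) ` strategies F T k \<xi> t v)"

definition theta ::
    "'w measure \<Rightarrow> (nat \<Rightarrow> 'w measure) \<Rightarrow> nat \<Rightarrow> 'd::finite \<Rightarrow> (nat \<Rightarrow> 'w \<Rightarrow> real ^ 'm::finite)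
      \<Rightarrow> (nat \<Rightarrow> real ^ 'm \<Rightarrow> real ^ 'd \<Rightarrow> real) \<Rightarrow> ('w \<Rightarrow> real ^ 'd) \<Rightarrow> nat
      \<Rightarrow> ('w \<Rightarrow> real ^ 'd) \<Rightarrow> 'w \<Rightarrow> ereal" where
  "theta M F T k S C \<xi> t v = ess_sup M (F t) {hedging_cost M F T k S C \<xi> (Suc t) v}"

definition one_step_cost ::
    "'w measure \<Rightarrow> (nat \<Rightarrow> 'w measure) \<Rightarrow> nat \<Rightarrow> 'd::finite \<Rightarrow> (nat \<Rightarrow> 'w \<Rightarrow> real ^ 'm::finite)
      \<Rightarrow> (nat \<Rightarrow> real ^ 'm \<Rightarrow> real ^ 'd \<Rightarrow> real) \<Rightarrow> ('w \<Rightarrow> real ^ 'd) \<Rightarrow> nat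
      \<Rightarrow> ('w \<Rightarrow> real ^ 'd) \<Rightarrow> ('w \<Rightarrow> real ^ 'd) \<Rightarrow> 'w \<Rightarrow> ereal" where
  "one_step_cost M F T k S C \<xi> t u v \<omega> =
     ereal (C t (S t \<omega>) (risky k (v \<omega> - u \<omega>))) + theta M F T k S C \<xi> t v \<omega>"

definition AIP_at ::
    "'w measure \<Rightarrow> (nat \<Rightarrow> 'w measure) \<Rightarrow> nat \<Rightarrow> 'd::finite \<Rightarrow> (nat \<Rightarrow> 'w \<Rightarrow> real ^ 'm::finite)
      \<Rightarrow> (nat \<Rightarrow> real ^ 'm \<Rightarrow> real ^ 'd \<Rightarrow> real) \<Rightarrow> nat \<Rightarrow> bool" where
  "AIP_at M F T k S C t \<longleftrightarrow>
     (AE \<omega> in M. hedging_cost M F T k S C (\<lambda>_. 0) t (\<lambda>_. 0) \<omega> = 0)"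

text \<open>At \<open>t = T\<close> there is no one-step cost and SAIP reduces to AIP.\<close>

definition SAIP_at ::
    "'w measure \<Rightarrow> (nat \<Rightarrow> 'w measure) \<Rightarrow> nat \<Rightarrow> 'd::finite \<Rightarrow> (nat \<Rightarrow> 'w \<Rightarrow> real ^ 'm::finite)
      \<Rightarrow> (nat \<Rightarrow> real ^ 'm \<Rightarrow> real ^ 'd \<Rightarrow> real) \<Rightarrow> nat \<Rightarrow> bool" where
  "SAIP_at M F T k S C t \<longleftrightarrow>
     AIP_at M F T k S C t \<and>
     (t < T \<longrightarrow> (\<forall>Z\<in>borel_measurable (F t).
        (AE \<omega> in M. one_step_cost M F T k S C (\<lambda>_. 0) t (\<lambda>_. 0) Z \<omega> = 0) \<longleftrightarrow>
        (AE \<omega> in M. risky k (Z \<omega>) = 0)))"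

definition SAIP ::
    "'w measure \<Rightarrow> (nat \<Rightarrow> 'w measure) \<Rightarrow> nat \<Rightarrow> 'd::finite \<Rightarrow> (nat \<Rightarrow> 'w \<Rightarrow> real ^ 'm::finite)
      \<Rightarrow> (nat \<Rightarrow> real ^ 'm \<Rightarrow> real ^ 'd \<Rightarrow> real) \<Rightarrow> bool" where
  "SAIP M F T k S C \<longleftrightarrow> (\<forall>t\<le>T. SAIP_at M F T k S C t)"

end

theory Submission
  imports Defs
begin

text \<open>
  The integrands are the value functions of the backward recursion itself, and they do not depend on
  \<open>\<omega>\<close>. At time \<open>T\<close> the value is the cost of trading into the payoff; at an earlier time it is the
  infimum over new positions of the trading cost plus the worst case of the next value over the
  conditional support. Two things have to be shown: these functions are lower semicontinuous with
  attained infima, and they compute the hedging costs.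

  Lower semicontinuity survives the supremum over the support because \<open>\<phi> t\<close> is lower
  hemicontinuous (\<open>lsc_Sup_hemicontinuous\<close>). It survives the infimum if the objective is coercive in
  the new position, locally uniformly in the price and the old position (\<open>lsc_coercive_Inf\<close>). This is
  where SAIP enters. For payoff zero and initial position zero it makes the objective positive on the
  compact unit sphere of risky positions, at almost every actual price (\<open>prices_secure\<close>). By lower
  semicontinuity positivity persists nearby, and superhomogeneity, which amounts to
  \<open>l * C t s x \<le> C t s (l *\<^sub>R x)\<close> for \<open>l \<ge> 1\<close>, makes the objective grow at least linearly. Super- or
  sub-additivity transfers this to other initial positions at a locally bounded expense, and
  monotonicity of the terminal cost transfers it to nonnegative payoffs (\<open>objective_coercive\<close>). The
  prices with this positivity form an open set, so redefining the value to be \<open>- \<infinity>\<close> elsewhere gives a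
  function that is lower semicontinuous everywhere.

  A sublevel set of a lower semicontinuous function of the next price is a random closed set, so by
  minimality of the conditional support the worst case over the support is the conditional essential
  supremum (\<open>worst_case_le\<close>). Hence every plan costs at least the value (\<open>val_bounds_step\<close>), and a
  measurable selection of minimal positions yields a plan that costs no more (\<open>val_attained_step\<close>).
  Both facts and the security of prices are proved together by backward induction
  (\<open>val_bounds_attained\<close>), because SAIP at time \<open>t\<close> is a statement about hedging costs at
  \<open>t + 1\<close>.
\<close>


section \<open>Lower semicontinuity\<close>

lemma lsc_iff_open: "lsc f \<longleftrightarrow> (\<forall>c. open {x. c < f x})"
proof
  assume "lsc f"
  then show "\<forall>c. open {x. c < f x}"
    using lsc_closed_le[of f] by (auto simp: closed_def Compl_eq not_le)
next
  assume *: "\<forall>c. open {x. c < f x}"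
  show "lsc f"
    unfolding lsc_def le_Liminf_iff
  proof (intro allI impI)
    fix x c assume "c < f x"
    with * show "\<forall>\<^sub>F y in at x. c < f y"
      by (auto simp: eventually_at_topological intro!: exI[of _ "{y. c < f y}"])
  qed
qed

lemma lsc_iff_eventually: "lsc f \<longleftrightarrow> (\<forall>x c. c < f x \<longrightarrow> (\<forall>\<^sub>F y in nhds x. c < f y))"
proof
  assume "lsc f"
  then have "open {x. c < f x}" for c by (simp add: lsc_iff_open)
  from eventually_nhds_in_open[OF this] show "\<forall>x c. c < f x \<longrightarrow> (\<forall>\<^sub>F y in nhds x. c < f y)"
    by simp
next
  assume *: "\<forall>x c. c < f x \<longrightarrow> (\<forall>\<^sub>F y in nhds x. c < f y)"
  have nbhd: "\<exists>T. open T \<and> x \<in> T \<and> T \<subseteq> {x. c < f x}" if "x \<in> {x. c < f x}" for x c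
    using * that by (simp add: eventually_nhds subset_eq)
  show "lsc f"
    unfolding lsc_iff_open by (intro allI Topological_Spaces.openI) (rule nbhd)
qed

lemma lsc_compose:
  assumes "lsc f" "continuous_on UNIV h"
  shows "lsc (\<lambda>x. f (h x))"
  unfolding lsc_iff_open
proof
  fix c
  have "open (h -` {x. c < f x})"
    using assms by (intro open_vimage) (auto simp: lsc_iff_open)
  then show "open {x. c < f (h x)}" by (simp add: vimage_def)
qed

lemma lsc_borel_measurable: "lsc f \<Longrightarrow> f \<in> borel_measurable borel"
  by (rule borel_measurableI_greater) (auto simp: lsc_iff_open)

lemma lsc_continuous:
  assumes "continuous_on UNIV f"
  shows "lsc (\<lambda>x. ereal (f x))"
  unfolding lsc_iff_open
  by (intro allI open_Collect_less continuous_intros assms continuous_on_ereal)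

lemma lsc_add:
  assumes f: "lsc (\<lambda>x. ereal (f x))" and h: "lsc h"
  shows "lsc (\<lambda>x. ereal (f x) + h x)"
  unfolding lsc_iff_eventually
proof (intro allI impI)
  fix x c assume c: "c < ereal (f x) + h x"
  have "c - ereal (f x) < h x"
    using c by (cases "h x"; cases c) (auto split: if_splits)
  then obtain b where b: "c - ereal (f x) < ereal b" "ereal b < h x"
    using ereal_dense2 by blast
  obtain a where a: "a < f x" "c \<le> ereal (a + b)"
  proof (cases c)
    case (real r)
    with b that[of "r - b"] show ?thesis by auto
  next
    case PInf
    with c show ?thesis by auto
  next
    case MInf
    with that[of "f x - 1"] show ?thesis by auto
  qed
  from a(1) have "ereal a < ereal (f x)" by simp
  then have "\<forall>\<^sub>F y in nhds x. ereal a < ereal (f y)"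
    using f unfolding lsc_iff_eventually by blast
  moreover have "\<forall>\<^sub>F y in nhds x. ereal b < h y"
    using h b(2) unfolding lsc_iff_eventually by blast
  ultimately show "\<forall>\<^sub>F y in nhds x. c < ereal (f y) + h y"
  proof eventually_elim
    case (elim y)
    then have "ereal (a + b) < ereal (f y) + h y"
      by (cases "h y") auto
    with a(2) show ?case by (rule le_less_trans)
  qed
qed

text \<open>If some \<open>s'\<close> in \<open>\<phi> s\<close> pushes the supremum above \<open>c\<close>, then so does every point close to \<open>s'\<close>,
  and for nearby \<open>s\<close> hemicontinuity keeps such a point in \<open>\<phi> s\<close>.\<close>

lemma lsc_Sup_hemicontinuous:
  assumes f: "lsc (\<lambda>(s, y). f s y)" and phi: "lower_hemicontinuous \<phi>"
  shows "lsc (\<lambda>(s, y). SUP s'\<in>\<phi> s. f s' y)"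
  unfolding lsc_iff_eventually
proof (intro allI impI, clarsimp simp: less_SUP_iff)
  fix s y c s' assume s': "s' \<in> \<phi> s" "c < f s' y"
  have "open {p. c < (case p of (s, y) \<Rightarrow> f s y)}"
    using f by (auto simp: lsc_iff_open)
  moreover have "(s', y) \<in> {p. c < (case p of (s, y) \<Rightarrow> f s y)}" using s' by simp
  ultimately obtain U W where UW': "open U" "open W" "(s', y) \<in> U \<times> W"
      "U \<times> W \<subseteq> {p. c < (case p of (s, y) \<Rightarrow> f s y)}"
    by (rule open_prod_elim)
  then have UW: "s' \<in> U" "y \<in> W" "\<And>a b. a \<in> U \<Longrightarrow> b \<in> W \<Longrightarrow> c < f a b" by auto
  have "open ({s. \<phi> s \<inter> U \<noteq> {}} \<times> W)"
    using phi UW' by (auto simp: lower_hemicontinuous_def intro: open_Times)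
  then have "\<forall>\<^sub>F p in nhds (s, y). p \<in> {s. \<phi> s \<inter> U \<noteq> {}} \<times> W"
    by (rule eventually_nhds_in_open) (use s' UW in auto)
  then show "\<forall>\<^sub>F p in nhds (s, y). c < (case p of (s, y) \<Rightarrow> SUP s'\<in>\<phi> s. f s' y)"
  proof eventually_elim
    case (elim p)
    then obtain s1 y1 s2 where "p = (s1, y1)" "s2 \<in> \<phi> s1" "s2 \<in> U" "y1 \<in> W" by auto
    with UW(3)[of s2 y1] show ?case by (auto simp: less_SUP_iff)
  qed
qed

lemma open_forall_compact:
  assumes "open W" "compact K"
  shows "open {x. \<forall>y\<in>K. (x, y) \<in> W}"
proof (rule Topological_Spaces.openI, clarsimp)
  fix x assume "\<forall>y\<in>K. (x, y) \<in> W"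
  then have "{x} \<times> K \<subseteq> W" by auto
  from Elementary_Topology.tube_lemma[OF assms(2,1) this]
  show "\<exists>T. open T \<and> x \<in> T \<and> T \<subseteq> {x. \<forall>y\<in>K. (x, y) \<in> W}" by blast
qed

lemma lsc_attains_Inf:
  assumes "lsc f" "compact K" "K \<noteq> {}"
  shows "\<exists>y\<in>K. \<forall>z\<in>K. f y \<le> f z"
proof (rule ccontr)
  assume no_min: "\<not> ?thesis"
  then have cover: "K \<subseteq> (\<Union>z\<in>K. {y. f z < f y})" by (auto simp: not_le)
  have "open {y. f z < f y}" for z using assms(1) by (simp add: lsc_iff_open)
  from compactE_image[OF assms(2) this cover]
  obtain D where D: "D \<subseteq> K" "finite D" "K \<subseteq> (\<Union>z\<in>D. {y. f z < f y})" .
  then have "Min (f ` D) \<in> f ` D" using assms(3) by (intro Min_in) auto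
  then obtain z where z: "z \<in> D" "f z = Min (f ` D)" by auto
  with D(1,3) obtain x where "x \<in> D" "f x < f z" by blast
  moreover from this(1) have "f z \<le> f x" unfolding z(2) using D(2) by simp
  ultimately show False by simp
qed

text \<open>Coercivity in the second variable, locally uniformly in the first one, is what keeps a
  partial infimum of a lower semicontinuous function lower semicontinuous and attained: it confines
  all almost minimal points to one compact set.\<close>

definition coercive_at ::
    "('p::topological_space \<times> 'y::topological_space \<Rightarrow> ereal) \<Rightarrow> 'y set \<Rightarrow> 'p \<Rightarrow> bool" where
  "coercive_at L E p \<longleftrightarrow>
     (\<forall>c::real. \<exists>K. compact K \<and> (\<forall>\<^sub>F q in nhds p. \<forall>y\<in>E - K. ereal c < L (q, y)))"

lemma eventually_less_Inf_compact:
  assumes L: "lsc L" and K: "compact K" and c: "\<And>y. y \<in> K \<Longrightarrow> c < L (p, y)"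
  shows "\<forall>\<^sub>F q in nhds p. \<forall>y\<in>K. c < L (q, y)"
proof -
  have "open {q. \<forall>y\<in>K. (q, y) \<in> {x. c < L x}}"
    using L K by (intro open_forall_compact) (auto simp: lsc_iff_open)
  from eventually_nhds_in_open[OF this, of p] c show ?thesis by simp
qed

lemma lsc_coercive_Inf:
  assumes L: "lsc L" and E: "closed E" and "open G"
    and coercive: "\<And>p. p \<in> G \<Longrightarrow> coercive_at L E p"
  shows "lsc (\<lambda>p. if p \<in> G then INF y\<in>E. L (p, y) else -\<infinity>)"
  unfolding lsc_iff_eventually
proof (intro allI impI)
  fix p c assume c: "c < (if p \<in> G then INF y\<in>E. L (p, y) else - \<infinity>)"
  then have p: "p \<in> G" and "c < (INF y\<in>E. L (p, y))" by (auto split: if_splits)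
  then obtain b where b: "c < ereal b" "ereal b < (INF y\<in>E. L (p, y))"
    using ereal_dense2 by blast
  \<comment> \<open>Beyond \<open>K\<close> the bound \<open>b\<close> holds by coercivity, on \<open>K\<close> by compactness.\<close>
  obtain K where K: "compact K" "\<forall>\<^sub>F q in nhds p. \<forall>y\<in>E - K. ereal b < L (q, y)"
    using coercive[OF p] unfolding coercive_at_def by blast
  have "\<forall>\<^sub>F q in nhds p. \<forall>y\<in>K \<inter> E. ereal b < L (q, y)"
    using b(2) by (intro eventually_less_Inf_compact L compact_Int_closed K E)
      (auto dest: less_INF_D)
  moreover have "\<forall>\<^sub>F q in nhds p. q \<in> G"
    using \<open>open G\<close> p by (rule eventually_nhds_in_open)
  ultimately show "\<forall>\<^sub>F q in nhds p. c < (if q \<in> G then INF y\<in>E. L (q, y) else - \<infinity>)"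
    using K(2)
  proof eventually_elim
    case (elim q)
    then have "ereal b \<le> (INF y\<in>E. L (q, y))"
      by (intro INF_greatest) (auto intro: less_imp_le)
    with b(1) elim show ?case by auto
  qed
qed

lemma coercive_Inf_attained:
  fixes E :: "'y::t2_space set"
  assumes L: "lsc L" and E: "closed E" "E \<noteq> {}" and coercive: "coercive_at L E p"
  shows "\<exists>y\<in>E. L (p, y) = (INF y\<in>E. L (p, y))"
proof (cases "(INF y\<in>E. L (p, y)) = \<infinity>")
  case True
  moreover obtain y where "y \<in> E" using E(2) by blast
  ultimately show ?thesis using INF_lower[of y E "\<lambda>y. L (p, y)"] by auto
next
  case False
  then obtain b where b: "(INF y\<in>E. L (p, y)) < ereal b"
    using ereal_dense2[of "INF y\<in>E. L (p, y)" \<infinity>] by auto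
  obtain K where K: "compact K" "\<forall>\<^sub>F q in nhds p. \<forall>y\<in>E - K. ereal b < L (q, y)"
    using coercive unfolding coercive_at_def by blast
  then have out: "ereal b < L (p, y)" if "y \<in> E" "y \<notin> K" for y
    using eventually_nhds_x_imp_x[OF K(2)] that by auto
  obtain z where z: "z \<in> E" "L (p, z) < ereal b" using b by (auto simp: INF_less_iff)
  with out[of z] have zK: "z \<in> K \<inter> E" by fastforce
  have "lsc (\<lambda>y. L (p, y))"
    by (rule lsc_compose[OF L]) (intro continuous_intros)
  from lsc_attains_Inf[OF this compact_Int_closed[OF K(1) E(1)]] zK
  obtain y where y: "y \<in> K \<inter> E" "\<And>z. z \<in> K \<inter> E \<Longrightarrow> L (p, y) \<le> L (p, z)"
    by blast
  have "L (p, y) \<le> L (p, x)" if x: "x \<in> E" for x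
  proof (cases "x \<in> K")
    case True
    with x show ?thesis by (intro y(2)) auto
  next
    case False
    have "L (p, y) \<le> L (p, z)" by (rule y(2)[OF zK])
    also have "\<dots> \<le> L (p, x)" using z(2) out[OF x False] by simp
    finally show ?thesis .
  qed
  then have "L (p, y) \<le> (INF y\<in>E. L (p, y))" by (rule INF_greatest)
  moreover have "(INF y\<in>E. L (p, y)) \<le> L (p, y)" using y(1) by (intro INF_lower) auto
  ultimately show ?thesis using y(1) by (intro bexI[of _ y] antisym) auto
qed


section \<open>Random closed sets and measurable selections\<close>

text \<open>For compact \<open>K\<close>, the pairs of a parameter \<open>p\<close> and a level \<open>c\<close> such that \<open>f (p, y) \<le> c\<close> for some
  \<open>y\<close> in \<open>K\<close> form a closed set, so hitting \<open>K\<close> is a measurable event. An open subset of a Euclidean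
  space is a countable union of compact sets, so hitting it is measurable as well.\<close>

lemma random_closed_set_sublevel:
  fixes f :: "'p::second_countable_topology \<times> 'y::euclidean_space \<Rightarrow> ereal"
  assumes f: "lsc f" and E: "closed E"
    and X: "X \<in> borel_measurable N" and Y: "Y \<in> borel_measurable N"
  shows "random_closed_set N (\<lambda>\<omega>. {y\<in>E. f (X \<omega>, y) \<le> Y \<omega>})"
  unfolding random_closed_set_def
proof (intro conjI ballI allI impI)
  fix \<omega>
  have "lsc (\<lambda>y. f (X \<omega>, y))"
    by (rule lsc_compose[OF f]) (intro continuous_intros)
  from closed_Int[OF E lsc_closed_le[OF this]]
  show "closed {y \<in> E. f (X \<omega>, y) \<le> Y \<omega>}" by (simp add: Int_def)
next
  fix U :: "'y set" assume "open U"
  from open_countable_Union_open_cbox[OF this]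
  obtain \<D> where D: "countable \<D>" "\<And>K. K \<in> \<D> \<Longrightarrow> \<exists>a b. K = cbox a b" "\<Union>\<D> = U"
    by metis
  have compact: "{\<omega>\<in>space N. \<exists>y\<in>K. f (X \<omega>, y) \<le> Y \<omega>} \<in> sets N" if K: "compact K" for K
  proof -
    let ?W = "{((p, c), y). c < f (p, y)}"
    have "open ?W"
    proof (rule Topological_Spaces.openI, clarsimp)
      fix p c y assume "c < f (p, y)"
      then obtain d where d: "c < d" "d < f (p, y)" using dense by blast
      let ?T = "{q. d < f (fst (fst q), snd q)} \<inter> {q. snd (fst q) < d}"
      have "lsc (\<lambda>q :: ('p \<times> ereal) \<times> 'y. f (fst (fst q), snd q))"
        by (rule lsc_compose[OF f]) (intro continuous_intros)
      then have "open {q :: ('p \<times> ereal) \<times> 'y. d < f (fst (fst q), snd q)}" by (simp add: lsc_iff_open)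
      moreover have "open {q :: ('p \<times> ereal) \<times> 'y. snd (fst q) < d}"
        by (intro open_Collect_less continuous_intros)
      ultimately have "open ?T" by (rule open_Int)
      with d show "\<exists>T. open T \<and> ((p, c), y) \<in> T \<and> T \<subseteq> ?W"
        by (intro exI[of _ ?T]) auto
    qed
    from open_forall_compact[OF this K]
    have "{q. \<forall>y\<in>K. (q, y) \<in> ?W} \<in> sets borel" by simp
    moreover have "(\<lambda>\<omega>. (X \<omega>, Y \<omega>)) \<in> borel_measurable N" using X Y by measurable
    ultimately have "space N - (\<lambda>\<omega>. (X \<omega>, Y \<omega>)) -` {q. \<forall>y\<in>K. (q, y) \<in> ?W} \<inter> space N \<in> sets N"
      by (intro sets.compl_sets measurable_sets)
    also have "space N - (\<lambda>\<omega>. (X \<omega>, Y \<omega>)) -` {q. \<forall>y\<in>K. (q, y) \<in> ?W} \<inter> space N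
        = {\<omega>\<in>space N. \<exists>y\<in>K. f (X \<omega>, y) \<le> Y \<omega>}"
      by (auto simp: not_less)
    finally show ?thesis .
  qed
  have "{\<omega>\<in>space N. {y \<in> E. f (X \<omega>, y) \<le> Y \<omega>} \<inter> U \<noteq> {}}
      = (\<Union>K\<in>\<D>. {\<omega>\<in>space N. \<exists>y\<in>K \<inter> E. f (X \<omega>, y) \<le> Y \<omega>})"
    using D(3) by auto
  also have "\<dots> \<in> sets N"
  proof (rule sets.countable_UN''[OF D(1)])
    fix K assume "K \<in> \<D>"
    then obtain a b where "K = cbox a b" using D(2) by blast
    then have "compact (K \<inter> E)" using E by (simp add: compact_Int_closed)
    then show "{\<omega>\<in>space N. \<exists>y\<in>K \<inter> E. f (X \<omega>, y) \<le> Y \<omega>} \<in> sets N" by (rule compact)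
  qed
  finally show "{\<omega>\<in>space N. {y \<in> E. f (X \<omega>, y) \<le> Y \<omega>} \<inter> U \<noteq> {}} \<in> sets N" .
qed

text \<open>The theorem of Kuratowski and Ryll-Nardzewski. Pointwise the selection is the limit of points
  of a countable dense set, each being the first one close enough to the set and to its
  predecessor; the index of that point is a measurable function because it asks only which balls
  meet the random set.\<close>

theorem random_closed_set_selection:
  fixes \<Gamma> :: "'w \<Rightarrow> 'y::polish_space set"
  assumes \<Gamma>: "random_closed_set N \<Gamma>" and ne: "\<And>\<omega>. \<omega> \<in> space N \<Longrightarrow> \<Gamma> \<omega> \<noteq> {}"
  obtains Z where "Z \<in> borel_measurable N" "\<And>\<omega>. \<omega> \<in> space N \<Longrightarrow> Z \<omega> \<in> \<Gamma> \<omega>"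
proof -
  obtain D :: "'y set" where D: "countable D" "\<And>X. open X \<Longrightarrow> X \<noteq> {} \<Longrightarrow> \<exists>d\<in>D. d \<in> X"
    by (rule countable_dense_setE) blast
  then have "D \<noteq> {}" by (metis UNIV_not_empty empty_iff open_UNIV)
  define d where "d = from_nat_into D"
  have dense: "\<exists>i. dist (d i) x < r" if "0 < r" for x r
  proof -
    have "\<exists>y\<in>D. y \<in> ball x r" using that by (intro D) auto
    then obtain y where "y \<in> D" "dist y x < r" by (auto simp: dist_commute)
    then show ?thesis using from_nat_into_surj[OF D(1)] by (metis d_def)
  qed
  let ?r = "\<lambda>n. (1/2::real) ^ n"
  define hits where "hits = (\<lambda>n j i \<omega>. \<Gamma> \<omega> \<inter> (ball (d i) (?r (Suc n)) \<inter> ball (d j) (?r n)) \<noteq> {})"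
  define I where "I = rec_nat (\<lambda>\<omega>. LEAST i. \<Gamma> \<omega> \<inter> ball (d i) 1 \<noteq> {})
    (\<lambda>n J \<omega>. LEAST i. hits n (J \<omega>) i \<omega>)"
  have I_0: "I 0 = (\<lambda>\<omega>. LEAST i. \<Gamma> \<omega> \<inter> ball (d i) 1 \<noteq> {})"
    and I_Suc: "I (Suc n) = (\<lambda>\<omega>. LEAST i. hits n (I n \<omega>) i \<omega>)" for n
    by (simp_all add: I_def)
  have hit_open: "Measurable.pred N (\<lambda>\<omega>. \<Gamma> \<omega> \<inter> U \<noteq> {})" if "open U" for U
    using \<Gamma> that by (simp add: random_closed_set_def pred_def)
  have I_measurable: "I n \<in> measurable N (count_space UNIV)" for n
  proof (induction n)
    case 0
    show ?case unfolding I_0 by (intro measurable_Least hit_open) auto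
  next
    case (Suc n)
    have "Measurable.pred N (hits n j i)" for j i
      unfolding hits_def by (intro hit_open) auto
    then have "(\<lambda>\<omega>. LEAST i. hits n j i \<omega>) \<in> measurable N (count_space UNIV)" for j
      by (rule measurable_Least)
    then show ?case
      unfolding I_Suc
      by (rule measurable_compose_countable[where f = "\<lambda>j \<omega>. LEAST i. hits n j i \<omega>", OF _ Suc])
  qed
  have close: "\<Gamma> \<omega> \<inter> ball (d (I n \<omega>)) (?r n) \<noteq> {}" if \<omega>: "\<omega> \<in> space N" for n \<omega>
  proof (induction n)
    case 0
    obtain x where x: "x \<in> \<Gamma> \<omega>" using ne[OF \<omega>] by blast
    obtain i where "dist (d i) x < 1" using dense[of 1 x] by auto
    with x have "\<Gamma> \<omega> \<inter> ball (d i) 1 \<noteq> {}" by auto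
    then have "\<Gamma> \<omega> \<inter> ball (d (I 0 \<omega>)) 1 \<noteq> {}"
      unfolding I_0 by (rule LeastI[of "\<lambda>i. \<Gamma> \<omega> \<inter> ball (d i) 1 \<noteq> {}"])
    then show ?case by simp
  next
    case (Suc n)
    then obtain x where x: "x \<in> \<Gamma> \<omega>" "x \<in> ball (d (I n \<omega>)) (?r n)" by blast
    obtain i where "dist (d i) x < ?r (Suc n)" using dense[of "?r (Suc n)" x] by auto
    with x have "hits n (I n \<omega>) i \<omega>" by (auto simp: hits_def)
    then have "hits n (I n \<omega>) (I (Suc n) \<omega>) \<omega>" unfolding I_Suc
      by (rule LeastI[of "\<lambda>i. hits n (I n \<omega>) i \<omega>"])
    then show ?case by (auto simp: hits_def)
  qed
  have step: "dist (d (I n \<omega>)) (d (I (Suc n) \<omega>)) \<le> 2 * ?r n" if \<omega>: "\<omega> \<in> space N" for n \<omega>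
  proof -
    obtain x where x: "x \<in> \<Gamma> \<omega>" "x \<in> ball (d (I n \<omega>)) (?r n)" using close[OF \<omega>] by blast
    obtain i where "dist (d i) x < ?r (Suc n)" using dense[of "?r (Suc n)" x] by auto
    with x have "hits n (I n \<omega>) i \<omega>" by (auto simp: hits_def)
    then have "hits n (I n \<omega>) (I (Suc n) \<omega>) \<omega>" unfolding I_Suc
      by (rule LeastI[of "\<lambda>i. hits n (I n \<omega>) i \<omega>"])
    then obtain z where "dist (d (I (Suc n) \<omega>)) z < ?r (Suc n)" "dist (d (I n \<omega>)) z < ?r n"
      by (auto simp: hits_def)
    then have "dist (d (I n \<omega>)) (d (I (Suc n) \<omega>)) < ?r n + ?r (Suc n)"
      by (intro dist_triangle_less_add)
    also have "\<dots> \<le> 2 * ?r n" by simp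
    finally show ?thesis by simp
  qed
  have telescope: "dist (d (I m \<omega>)) (d (I (m + j) \<omega>)) \<le> 4 * ?r m - 4 * ?r (m + j)"
    if \<omega>: "\<omega> \<in> space N" for m j \<omega>
  proof (induction j)
    case (Suc j)
    have "dist (d (I m \<omega>)) (d (I (m + Suc j) \<omega>))
        \<le> dist (d (I m \<omega>)) (d (I (m + j) \<omega>)) + dist (d (I (m + j) \<omega>)) (d (I (Suc (m + j)) \<omega>))"
      by (simp add: dist_triangle)
    also have "\<dots> \<le> (4 * ?r m - 4 * ?r (m + j)) + 2 * ?r (m + j)"
      using Suc step[OF \<omega>, of "m + j"] by (intro add_mono) auto
    finally show ?case by simp
  qed simp
  have "Cauchy (\<lambda>n. d (I n \<omega>))" if \<omega>: "\<omega> \<in> space N" for \<omega>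
  proof (rule metric_CauchyI)
    fix e :: real assume "0 < e"
    then obtain m where m: "?r m < e / 8"
      using real_arch_pow_inv[of "e / 8" "1 / 2"] by auto
    have far: "dist (d (I m \<omega>)) (d (I n \<omega>)) < e / 2" if "m \<le> n" for n
    proof -
      have "dist (d (I m \<omega>)) (d (I n \<omega>)) \<le> 4 * ?r m - 4 * ?r n"
        using telescope[OF \<omega>, of m "n - m"] that by simp
      also have "\<dots> \<le> 4 * ?r m" by simp
      finally show ?thesis using m by linarith
    qed
    show "\<exists>M. \<forall>m\<ge>M. \<forall>n\<ge>M. dist (d (I m \<omega>)) (d (I n \<omega>)) < e"
      using far by (metis dist_commute dist_triangle_half_l)
  qed
  then have lim: "(\<lambda>n. d (I n \<omega>)) \<longlonglongrightarrow> lim (\<lambda>n. d (I n \<omega>))" if "\<omega> \<in> space N" for \<omega>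
    using that Cauchy_convergent convergent_LIMSEQ_iff by blast
  show ?thesis
  proof (rule that[of "\<lambda>\<omega>. lim (\<lambda>n. d (I n \<omega>))"])
    have "(\<lambda>\<omega>. d (I n \<omega>)) \<in> borel_measurable N" for n
      by (rule measurable_compose[OF I_measurable]) simp
    then show "(\<lambda>\<omega>. lim (\<lambda>n. d (I n \<omega>))) \<in> borel_measurable N"
      by (rule borel_measurable_LIMSEQ_metric[where f = "\<lambda>n \<omega>. d (I n \<omega>)"]) (rule lim)
  next
    fix \<omega> assume \<omega>: "\<omega> \<in> space N"
    have "\<exists>x\<in>\<Gamma> \<omega>. dist (d (I n \<omega>)) x < ?r n" for n
      using close[OF \<omega>, of n] by auto
    then obtain x where x: "\<And>n. x n \<in> \<Gamma> \<omega>" "\<And>n. dist (d (I n \<omega>)) (x n) < ?r n"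
      by metis
    let ?l = "lim (\<lambda>n. d (I n \<omega>))"
    have "(\<lambda>n. ?r n + dist (d (I n \<omega>)) ?l) \<longlonglongrightarrow> 0 + 0"
      by (intro tendsto_add LIMSEQ_power_zero iffD1[OF tendsto_dist_iff] lim[OF \<omega>]) simp
    then have bound_to_0: "(\<lambda>n. ?r n + dist (d (I n \<omega>)) ?l) \<longlonglongrightarrow> 0" by simp
    have "norm (dist (x n) ?l) \<le> ?r n + dist (d (I n \<omega>)) ?l" for n
      using dist_triangle3[of "x n" ?l "d (I n \<omega>)"] x(2)[of n] by simp
    then have "(\<lambda>n. dist (x n) ?l) \<longlonglongrightarrow> 0"
      by (intro Lim_null_comparison[OF always_eventually bound_to_0] allI)
    then have "x \<longlonglongrightarrow> ?l" by (rule iffD2[OF tendsto_dist_iff])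
    moreover have "closed (\<Gamma> \<omega>)" using \<Gamma> \<omega> by (auto simp: random_closed_set_def)
    ultimately show "lim (\<lambda>n. d (I n \<omega>)) \<in> \<Gamma> \<omega>"
      using x(1) closed_sequentially[of "\<Gamma> \<omega>" x] by simp
  qed
qed

lemma measurable_selection_sublevel:
  fixes f :: "'p::second_countable_topology \<times> 'y::euclidean_space \<Rightarrow> ereal"
  assumes "lsc f" "closed E" "X \<in> borel_measurable N" "Y \<in> borel_measurable N"
    and "\<And>\<omega>. \<omega> \<in> space N \<Longrightarrow> \<exists>y\<in>E. f (X \<omega>, y) \<le> Y \<omega>"
  obtains Z where "Z \<in> borel_measurable N"
    "\<And>\<omega>. \<omega> \<in> space N \<Longrightarrow> Z \<omega> \<in> E \<and> f (X \<omega>, Z \<omega>) \<le> Y \<omega>"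
proof -
  from random_closed_set_selection[OF random_closed_set_sublevel[OF assms(1-4)]] assms(5)
  obtain Z where "Z \<in> borel_measurable N"
      "\<And>\<omega>. \<omega> \<in> space N \<Longrightarrow> Z \<omega> \<in> {y\<in>E. f (X \<omega>, y) \<le> Y \<omega>}"
    by blast
  then show ?thesis by (intro that[of Z]) auto
qed


section \<open>Essential bounds\<close>

text \<open>Minimizing the expectation of a bounded strictly increasing function over all measurable upper
  bounds finds the smallest one; the candidate is the infimum of a minimizing sequence.\<close>

lemma (in prob_space) ess_sup_exists:
  assumes N: "subalgebra M N"
  shows "\<exists>Z. is_ess_sup M N A Z"
proof -
  (* Any bounded strictly increasing function would do. *)
  define \<psi> :: "ereal \<Rightarrow> real" where
    "\<psi> x = (if x = \<infinity> then 2 else if x = -\<infinity> then -2 else arctan (real_of_ereal x))" for x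
  have arctan_bound: "\<bar>arctan x\<bar> < 2" for x
    using arctan_lbound[of x] arctan_ubound[of x] pi_less_4 by linarith
  have \<psi>_less: "\<psi> x < \<psi> y" if "x < y" for x y
    using that arctan_bound
    by (cases x; cases y) (auto simp: \<psi>_def arctan_less_iff abs_less_iff minus_less_iff)
  then have \<psi>_mono: "\<psi> x \<le> \<psi> y" if "x \<le> y" for x y
    using that by (metis order.order_iff_strict)
  have \<psi>_bound: "\<bar>\<psi> x\<bar> \<le> 2" for x
    using arctan_bound by (auto simp: \<psi>_def intro: less_imp_le)
  have \<psi>_measurable: "\<psi> \<in> borel_measurable borel" unfolding \<psi>_def by measurable
  define \<Y> where "\<Y> = {Y\<in>borel_measurable N. \<forall>X\<in>A. AE \<omega> in M. X \<omega> \<le> Y \<omega>}"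
  have int: "integrable M (\<lambda>\<omega>. \<psi> (Y \<omega>))" if "Y \<in> \<Y>" for Y
  proof (rule integrable_const_bound[of _ 2])
    have "Y \<in> borel_measurable M"
      using that by (auto simp: \<Y>_def intro: measurable_from_subalg[OF N])
    then show "(\<lambda>\<omega>. \<psi> (Y \<omega>)) \<in> borel_measurable M"
      by (rule measurable_compose[OF _ \<psi>_measurable])
  qed (simp add: \<psi>_bound)
  have "(\<lambda>_. \<infinity>) \<in> \<Y>" by (auto simp: \<Y>_def)
  then have ne: "\<Y> \<noteq> {}" by blast
  have bdd: "bdd_below ((\<lambda>Y. \<integral>\<omega>. \<psi> (Y \<omega>) \<partial>M) ` \<Y>)"
  proof (rule bdd_belowI2)
    fix Y assume "Y \<in> \<Y>"
    moreover have "- 2 \<le> \<psi> x" for x using \<psi>_bound[of x] by linarith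
    ultimately have "(\<integral>\<omega>. - 2 \<partial>M) \<le> (\<integral>\<omega>. \<psi> (Y \<omega>) \<partial>M)"
      by (intro integral_mono int) simp_all
    then show "- 2 \<le> (\<integral>\<omega>. \<psi> (Y \<omega>) \<partial>M)" by (simp add: prob_space)
  qed
  define c where "c = (INF Y\<in>\<Y>. \<integral>\<omega>. \<psi> (Y \<omega>) \<partial>M)"
  have "\<exists>Y\<in>\<Y>. (\<integral>\<omega>. \<psi> (Y \<omega>) \<partial>M) < c + 1 / Suc n" for n
    unfolding c_def by (subst cINF_less_iff[OF ne bdd, symmetric]) simp
  then obtain Y where Y: "\<And>n. Y n \<in> \<Y>" "\<And>n. (\<integral>\<omega>. \<psi> (Y n \<omega>) \<partial>M) < c + 1 / Suc n"
    by metis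
  define Z where "Z = (\<lambda>\<omega>. INF n. Y n \<omega>)"
  have Z: "Z \<in> \<Y>"
    using Y(1) by (auto simp: \<Y>_def Z_def le_INF_iff AE_all_countable intro!: borel_measurable_INF)
  have Z_le: "(\<integral>\<omega>. \<psi> (Z \<omega>) \<partial>M) \<le> c"
  proof (rule field_le_epsilon)
    fix e :: real assume "0 < e"
    then obtain n where n: "1 / Suc n < e" using nat_approx_posE by blast
    have "(\<integral>\<omega>. \<psi> (Z \<omega>) \<partial>M) \<le> (\<integral>\<omega>. \<psi> (Y n \<omega>) \<partial>M)"
      by (intro integral_mono int Z Y(1) \<psi>_mono) (auto simp: Z_def intro: INF_lower)
    with Y(2)[of n] n show "(\<integral>\<omega>. \<psi> (Z \<omega>) \<partial>M) \<le> c + e" by linarith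
  qed
  have "AE \<omega> in M. Z \<omega> \<le> W \<omega>" if W: "W \<in> \<Y>" for W
  proof -
    let ?W = "\<lambda>\<omega>. min (Z \<omega>) (W \<omega>)"
    have mW: "?W \<in> \<Y>"
      using Z W by (auto simp: \<Y>_def intro!: borel_measurable_min)
    then have "c \<le> (\<integral>\<omega>. \<psi> (?W \<omega>) \<partial>M)"
      unfolding c_def by (intro cINF_lower bdd)
    with Z_le have "(\<integral>\<omega>. \<psi> (Z \<omega>) - \<psi> (?W \<omega>) \<partial>M) \<le> 0"
      by (subst Bochner_Integration.integral_diff) (auto intro: int Z mW)
    moreover have nonneg: "0 \<le> \<psi> (Z \<omega>) - \<psi> (?W \<omega>)" for \<omega>
      by (simp add: \<psi>_mono)
    ultimately have "(\<integral>\<omega>. \<psi> (Z \<omega>) - \<psi> (?W \<omega>) \<partial>M) = 0"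
      by (intro antisym integral_nonneg_AE always_eventually) auto
    then have "AE \<omega> in M. \<psi> (Z \<omega>) - \<psi> (?W \<omega>) = 0"
      using integral_nonneg_eq_0_iff_AE[OF Bochner_Integration.integrable_diff[OF int[OF Z] int[OF mW]]]
        nonneg by simp
    then show ?thesis
    proof eventually_elim
      case (elim \<omega>)
      then show ?case
        using \<psi>_less[of "W \<omega>" "Z \<omega>"] by (cases "Z \<omega> \<le> W \<omega>") (simp_all add: min_def not_le)
    qed
  qed
  with Z have "is_ess_sup M N A Z"
    by (auto simp: is_ess_sup_def \<Y>_def)
  then show ?thesis by (intro exI[of _ Z])
qed

lemma (in prob_space) is_ess_sup_ess_sup: "subalgebra M N \<Longrightarrow> is_ess_sup M N A (ess_sup M N A)"
  using someI_ex[OF ess_sup_exists] by (simp add: ess_sup_def)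

lemma (in prob_space) is_ess_inf_ess_inf:
  assumes "subalgebra M N"
  shows "is_ess_inf M N A (ess_inf M N A)"
proof -
  let ?B = "(\<lambda>X \<omega>. - X \<omega>) ` A"
  obtain Z where Z: "is_ess_sup M N ?B Z" using ess_sup_exists[OF assms] by blast
  have "is_ess_inf M N A (\<lambda>\<omega>. - Z \<omega>)"
    unfolding is_ess_inf_def
  proof (intro conjI ballI impI)
    show "(\<lambda>\<omega>. - Z \<omega>) \<in> borel_measurable N" using Z by (simp add: is_ess_sup_def)
    show "AE \<omega> in M. - Z \<omega> \<le> X \<omega>" if "X \<in> A" for X
      using Z that by (auto simp: is_ess_sup_def ereal_uminus_le_reorder)
    fix Y assume Y: "Y \<in> borel_measurable N" "\<forall>X\<in>A. AE \<omega> in M. Y \<omega> \<le> X \<omega>"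
    then have "(\<lambda>\<omega>. - Y \<omega>) \<in> borel_measurable N" by measurable
    with Z Y have "AE \<omega> in M. Z \<omega> \<le> - Y \<omega>" by (force simp: is_ess_sup_def)
    then show "AE \<omega> in M. Y \<omega> \<le> - Z \<omega>"
    proof eventually_elim
      case (elim \<omega>)
      then show ?case using ereal_minus_le_minus[of "- Y \<omega>" "Z \<omega>"] by simp
    qed
  qed
  from someI[of "is_ess_inf M N A", OF this] show ?thesis by (simp add: ess_inf_def)
qed


section \<open>Risky positions\<close>

lemma risky_add: "risky k (x + y) = risky k x + risky k y"
  and risky_diff: "risky k (x - y) = risky k x - risky k y"
  and risky_minus: "risky k (- x) = - risky k x"
  and risky_scaleR: "risky k (a *\<^sub>R x) = a *\<^sub>R risky k x"
  and risky_0: "risky k 0 = 0"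
  and risky_risky: "risky k (risky k x) = risky k x"
  and risky_nth: "risky k x $ k = 0"
  by (simp_all add: risky_def vec_eq_iff)

lemma risky_eq: "x $ k = 0 \<Longrightarrow> risky k x = x"
  by (simp add: risky_def vec_eq_iff)

lemma risky_plus_cash: "risky k x + (x $ k) *\<^sub>R cash k = x"
  by (simp add: risky_def vec_eq_iff axis_def)

lemma continuous_on_risky [continuous_intros]:
  "continuous_on A f \<Longrightarrow> continuous_on A (\<lambda>x. risky k (f x))"
  unfolding risky_def
proof (rule continuous_on_vec_lambda)
  fix i
  assume "continuous_on A f"
  then show "continuous_on A (\<lambda>x. if i = k then 0 else f x $ i)"
    by (cases "i = k") (simp_all add: continuous_on_component)
qed

text \<open>The space of the non-cash parts of positions, embedded by \<open>risky\<close>.\<close>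

definition risky_space :: "'d::finite \<Rightarrow> (real ^ 'd) set" where
  "risky_space k = {y. y $ k = 0}"

lemma closed_risky_space: "closed (risky_space k)"
  unfolding risky_space_def by (intro closed_Collect_eq continuous_intros)

text \<open>The cost functions are normalized and superhomogeneous only at nonnegative prices. Composing them
  with the positive part, which is continuous and does not change an actual price, makes these
  properties available at all prices without disturbing lower semicontinuity.\<close>

definition pos_part :: "real ^ 'm::finite \<Rightarrow> real ^ 'm" where
  "pos_part s = (\<chi> i. max 0 (s $ i))"

lemma pos_part_nonneg: "0 \<le> pos_part s"
  by (simp add: pos_part_def less_eq_vec_def)

lemma pos_part_eq: "0 \<le> s \<Longrightarrow> pos_part s = s"
  by (simp add: pos_part_def less_eq_vec_def vec_eq_iff max_absorb2)

lemma continuous_on_pos_part [continuous_intros]: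
  "continuous_on A f \<Longrightarrow> continuous_on A (\<lambda>x. pos_part (f x))"
  unfolding pos_part_def by (intro continuous_intros)


section \<open>The value functions\<close>

locale supported_market = cost_market M F T k S C
  for M :: "'w measure" and F :: "nat \<Rightarrow> 'w measure" and T :: nat
    and k :: "'d::finite"
    and S :: "nat \<Rightarrow> 'w \<Rightarrow> real ^ 'm::finite"
    and C :: "nat \<Rightarrow> real ^ 'm \<Rightarrow> real ^ 'd \<Rightarrow> real" +
  fixes \<phi> :: "nat \<Rightarrow> real ^ 'm \<Rightarrow> (real ^ 'm) set"
  assumes support: "t < T \<Longrightarrow> is_cond_supp M (F t) (S (Suc t)) (\<lambda>\<omega>. \<phi> t (S t \<omega>))"
    and hemicontinuous: "t < T \<Longrightarrow> lower_hemicontinuous (\<phi> t)"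
    and additivity: "t \<le> T \<Longrightarrow> (\<forall>s. super_additive (C t s)) \<or> (\<forall>s. sub_additive (C t s))"
    and cost_scale: "t \<le> T \<Longrightarrow> 1 \<le> l \<Longrightarrow> 0 \<le> s \<Longrightarrow> l * C t s x \<le> C t s (l *\<^sub>R x)"
begin

definition worst_case ::
    "nat \<Rightarrow> (real ^ 'm \<Rightarrow> real ^ 'd \<Rightarrow> ereal) \<Rightarrow> real ^ 'm \<Rightarrow> real ^ 'd \<Rightarrow> ereal" where
  "worst_case t f s y = (SUP s'\<in>\<phi> t (pos_part s). f s' y)"

definition objective ::
    "nat \<Rightarrow> (real ^ 'm \<Rightarrow> real ^ 'd \<Rightarrow> ereal) \<Rightarrow> real ^ 'm \<Rightarrow> real ^ 'd \<Rightarrow> real ^ 'd \<Rightarrow> ereal" where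
  "objective t f s v y = ereal (C t (pos_part s) (risky k (y - v))) + worst_case t f s y"

text \<open>With \<open>f\<close> the next value function for the payoff zero, these are the prices at which holding any
  normalized risky position has strictly positive worst-case cost. SAIP will place the actual price
  there almost surely.\<close>

definition secure_prices :: "nat \<Rightarrow> (real ^ 'm \<Rightarrow> real ^ 'd \<Rightarrow> ereal) \<Rightarrow> (real ^ 'm) set" where
  "secure_prices t f = {s. \<forall>y\<in>risky_space k \<inter> sphere 0 1. 0 < objective t f s 0 y}"

text \<open>The index counts the remaining dates. Coercivity, hence lower semicontinuity of the infimum, is only
  known over the secure prices. They form an open set, so the value \<open>- \<infinity>\<close> elsewhere is compatible with
  lower semicontinuity, and it is harmless because the actual price is almost surely secure.\<close>

primrec remaining_value ::
    "nat \<Rightarrow> (real ^ 'm \<Rightarrow> real ^ 'd) \<Rightarrow> real ^ 'm \<Rightarrow> real ^ 'd \<Rightarrow> ereal" where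
  "remaining_value 0 = (\<lambda>g s v. ereal (g s $ k + C T (pos_part s) (risky k (g s - v))))"
| "remaining_value (Suc n) = (\<lambda>g s v.
     if s \<in> secure_prices (T - Suc n) (remaining_value n (\<lambda>_. 0))
     then INF y\<in>risky_space k. objective (T - Suc n) (remaining_value n g) s v y
     else - \<infinity>)"

definition val :: "nat \<Rightarrow> (real ^ 'm \<Rightarrow> real ^ 'd) \<Rightarrow> real ^ 'm \<Rightarrow> real ^ 'd \<Rightarrow> ereal" where
  "val t = remaining_value (T - t)"

abbreviation secure :: "nat \<Rightarrow> (real ^ 'm) set" where
  "secure t \<equiv> secure_prices t (val (Suc t) (\<lambda>_. 0))"

lemma val_T: "val T g s v = ereal (g s $ k + C T (pos_part s) (risky k (g s - v)))"
  by (simp add: val_def)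

lemma val_step:
  assumes "t < T"
  shows "val t g s v =
    (if s \<in> secure t then INF y\<in>risky_space k. objective t (val (Suc t) g) s v y else - \<infinity>)"
proof -
  have *: "T - t = Suc (T - Suc t)" "T - Suc (T - Suc t) = t" using assms by auto
  show ?thesis unfolding val_def * remaining_value.simps by (rule refl)
qed

lemma val_risky: "t \<le> T \<Longrightarrow> val t g s (risky k v) = val t g s v"
  by (cases "t = T") (simp_all add: val_T val_step objective_def risky_diff risky_risky)

lemma objective_risky:
  "t < T \<Longrightarrow> objective t (val (Suc t) g) s v (risky k y) = objective t (val (Suc t) g) s v y"
  by (simp add: objective_def worst_case_def risky_diff risky_risky val_risky)

text \<open>The payoff enters only through the last date, where nonnegative payoffs are dearer than zero because
  \<open>C T\<close> is monotone and translates along the cash axis; the recursion preserves the order.\<close>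

lemma val_zero_le_val:
  assumes "t \<le> T" "\<And>s. 0 \<le> g s"
  shows "val t (\<lambda>_. 0) s v \<le> val t g s v"
  using assms(1)
proof (induction arbitrary: s v rule: inc_induct)
  case base
  have "C T (pos_part s) (risky k (g s - v)) + g s $ k
      = C T (pos_part s) (risky k (g s - v) + (g s $ k) *\<^sub>R cash k)"
    by (simp add: cost_cash)
  also have "risky k (g s - v) + (g s $ k) *\<^sub>R cash k = g s - risky k v"
    using risky_plus_cash[of k "g s"] by (simp add: risky_diff algebra_simps)
  also have "C T (pos_part s) (g s - risky k v) \<ge> C T (pos_part s) (risky k (0 - v))"
    using assms(2) by (intro cost_mono) (simp add: risky_minus)
  finally show ?case by (simp add: val_T)
next
  case (step t)
  have "objective t (val (Suc t) (\<lambda>_. 0)) s v y \<le> objective t (val (Suc t) g) s v y" for s v y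
    unfolding objective_def worst_case_def by (intro add_left_mono SUP_mono') (rule step.IH)
  then show ?case using step.hyps by (auto simp: val_step intro!: INF_mono')
qed

lemma scale_worst_case:
  assumes "0 < l" and f: "\<And>s y. ereal l * f s y \<le> f s (l *\<^sub>R y)"
  shows "ereal l * worst_case t f s y \<le> worst_case t f s (l *\<^sub>R y)"
proof -
  have "worst_case t f s y \<le> worst_case t f s (l *\<^sub>R y) / ereal l"
    unfolding worst_case_def
  proof (rule SUP_least)
    fix s' assume s': "s' \<in> \<phi> t (pos_part s)"
    have "ereal l * f s' y \<le> f s' (l *\<^sub>R y)" by (rule f)
    also have "\<dots> \<le> (SUP s'\<in>\<phi> t (pos_part s). f s' (l *\<^sub>R y))" using s' by (rule SUP_upper)
    finally show "f s' y \<le> (SUP s'\<in>\<phi> t (pos_part s). f s' (l *\<^sub>R y)) / ereal l"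
      using \<open>0 < l\<close> by (simp add: ereal_le_divide_pos)
  qed
  then show ?thesis using \<open>0 < l\<close> by (simp add: ereal_le_divide_pos)
qed

lemma scale_objective:
  assumes "t \<le> T" "1 \<le> l" and f: "\<And>s y. ereal l * f s y \<le> f s (l *\<^sub>R y)"
  shows "ereal l * objective t f s v y \<le> objective t f s (l *\<^sub>R v) (l *\<^sub>R y)"
proof -
  have l: "0 < l" using assms(2) by simp
  have "ereal l * objective t f s v y
      = ereal (l * C t (pos_part s) (risky k (y - v))) + ereal l * worst_case t f s y"
    using l by (simp add: objective_def ereal_pos_distrib)
  also have "\<dots> \<le> objective t f s (l *\<^sub>R v) (l *\<^sub>R y)"
    unfolding objective_def
  proof (rule add_mono)
    show "ereal l * worst_case t f s y \<le> worst_case t f s (l *\<^sub>R y)"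
      by (intro scale_worst_case l f)
    show "ereal (l * C t (pos_part s) (risky k (y - v)))
        \<le> ereal (C t (pos_part s) (risky k (l *\<^sub>R y - l *\<^sub>R v)))"
      using cost_scale[OF assms(1,2) pos_part_nonneg, of s "risky k (y - v)"]
      by (simp add: risky_scaleR[symmetric] scaleR_diff_right)
  qed
  finally show ?thesis .
qed

text \<open>Superhomogeneity passes through the supremum and, after rescaling the position minimized over,
  through the infimum of the recursion.\<close>

lemma scale_val_zero:
  assumes "t \<le> T" and l: "1 \<le> l"
  shows "ereal l * val t (\<lambda>_. 0) s v \<le> val t (\<lambda>_. 0) s (l *\<^sub>R v)"
  using assms(1)
proof (induction arbitrary: s v rule: inc_induct)
  case base
  show ?case
    using cost_scale[OF order_refl l pos_part_nonneg, of s "- risky k v"]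
    by (simp add: val_T risky_minus risky_scaleR)
next
  case (step t)
  have "ereal l * (INF y\<in>risky_space k. objective t (val (Suc t) (\<lambda>_. 0)) s v y)
      \<le> objective t (val (Suc t) (\<lambda>_. 0)) s (l *\<^sub>R v) z" if z: "z \<in> risky_space k" for z
  proof -
    let ?y = "(1 / l) *\<^sub>R z"
    have "?y \<in> risky_space k" using z by (simp add: risky_space_def)
    then have "ereal l * (INF y\<in>risky_space k. objective t (val (Suc t) (\<lambda>_. 0)) s v y)
        \<le> ereal l * objective t (val (Suc t) (\<lambda>_. 0)) s v ?y"
      using l by (intro ereal_mult_left_mono INF_lower) auto
    also have "\<dots> \<le> objective t (val (Suc t) (\<lambda>_. 0)) s (l *\<^sub>R v) (l *\<^sub>R ?y)"
      using step.hyps by (intro scale_objective l step.IH) auto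
    also have "l *\<^sub>R ?y = z" using l by simp
    finally show ?thesis .
  qed
  moreover have "ereal l * - \<infinity> = - \<infinity>" using l by simp
  ultimately show ?case
    using step.hyps by (auto simp: val_step intro!: INF_greatest)
qed

lemma lsc_objective:
  assumes t: "t < T" and f: "lsc (\<lambda>(s, y). f s y)"
  shows "lsc (\<lambda>((s, v), y). objective t f s v y)"
proof -
  have "continuous_on UNIV
      (\<lambda>q :: ((real^'m) \<times> (real^'d)) \<times> (real^'d). (pos_part (fst (fst q)), risky k (snd q - snd (fst q))))"
    by (intro continuous_intros)
  from lsc_compose[OF cost_lsc[of t] this] t
  have "lsc (\<lambda>q. ereal (C t (pos_part (fst (fst q))) (risky k (snd q - snd (fst q)))))" by simp
  moreover have "continuous_on UNIV
      (\<lambda>q :: ((real^'m) \<times> (real^'d)) \<times> (real^'d). (pos_part (fst (fst q)), snd q))"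
    by (intro continuous_intros)
  from lsc_compose[OF lsc_Sup_hemicontinuous[OF f hemicontinuous[OF t]] this]
  have "lsc (\<lambda>q :: ((real^'m) \<times> (real^'d)) \<times> (real^'d). worst_case t f (fst (fst q)) (snd q))"
    by (simp add: worst_case_def)
  ultimately have "lsc (\<lambda>q. ereal (C t (pos_part (fst (fst q))) (risky k (snd q - snd (fst q))))
      + worst_case t f (fst (fst q)) (snd q))"
    by (rule lsc_add)
  then show ?thesis by (simp add: objective_def case_prod_unfold)
qed

lemma lsc_objective_from_0:
  assumes "t < T" "lsc (\<lambda>(s, y). f s y)"
  shows "lsc (\<lambda>(s, y). objective t f s 0 y)"
proof -
  have "continuous_on UNIV (\<lambda>q :: (real^'m) \<times> (real^'d). ((fst q, 0), snd q))"
    by (intro continuous_intros)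
  from lsc_compose[OF lsc_objective[OF assms] this] show ?thesis
    by (simp add: case_prod_unfold)
qed

lemma compact_risky_sphere: "compact (risky_space k \<inter> sphere 0 1)"
  using compact_Int_closed[OF compact_sphere closed_risky_space, of 0 1 k] by (simp add: Int_commute)

lemma open_secure:
  assumes "t < T" "lsc (\<lambda>(s, y). val (Suc t) (\<lambda>_. 0) s y)"
  shows "open (secure t)"
proof -
  have "open {q. 0 < (case q of (s, y) \<Rightarrow> objective t (val (Suc t) (\<lambda>_. 0)) s 0 y)}"
    using lsc_objective_from_0[OF assms] by (simp add: lsc_iff_open)
  from open_forall_compact[OF this compact_risky_sphere] show ?thesis
    by (simp add: secure_prices_def)
qed

text \<open>Trading from \<open>v\<close> instead of from \<open>0\<close> lowers the cost at most by a locally bounded amount: by the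
  size of \<open>C t s (- v)\<close> if the cost is super-additive, of \<open>C t s v\<close> if it is sub-additive.\<close>

lemma cost_shift:
  assumes t: "t \<le> T"
  obtains h :: "(real ^ 'm) \<times> (real ^ 'd) \<Rightarrow> real" where "continuous_on UNIV h"
    "\<And>s v y. C t (pos_part s) (risky k y) - h (s, v) \<le> C t (pos_part s) (risky k (y - v))"
proof -
  obtain h where h: "continuous_on UNIV (\<lambda>(s, x). h s x)" "\<And>s x. \<bar>C t s x\<bar> \<le> h s x"
    using cost_bound[OF t] by blast
  let ?h = "\<lambda>p. h (pos_part (fst p)) (risky k (snd p)) + h (pos_part (fst p)) (risky k (- snd p))"
  show ?thesis
  proof (rule that[of ?h])
    have "continuous_on UNIV (\<lambda>p. case (pos_part (fst p), risky k (snd p)) of (s, x) \<Rightarrow> h s x)"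
      "continuous_on UNIV (\<lambda>p. case (pos_part (fst p), risky k (- snd p)) of (s, x) \<Rightarrow> h s x)"
      by (rule continuous_on_compose2[OF h(1)]; auto intro!: continuous_intros)+
    then show "continuous_on UNIV ?h" by (intro continuous_on_add) simp_all
  next
    fix s v y
    let ?C = "\<lambda>x. C t (pos_part s) (risky k x)"
    have bounds: "\<bar>?C v\<bar> \<le> h (pos_part s) (risky k v)" "\<bar>?C (- v)\<bar> \<le> h (pos_part s) (risky k (- v))"
      using h(2) by auto
    from additivity[OF t] show "?C y - ?h (s, v) \<le> ?C (y - v)"
    proof
      assume "\<forall>s. super_additive (C t s)"
      then have "?C y + ?C (- v) \<le> C t (pos_part s) (risky k y + risky k (- v))"
        unfolding super_additive_def by blast
      also have "risky k y + risky k (- v) = risky k (y - v)" by (simp add: risky_add[symmetric])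
      finally show ?thesis using bounds by simp
    next
      assume "\<forall>s. sub_additive (C t s)"
      then have "C t (pos_part s) (risky k (y - v) + risky k v) \<le> ?C (y - v) + ?C v"
        unfolding sub_additive_def by blast
      also have "risky k (y - v) + risky k v = risky k y" by (simp add: risky_add[symmetric])
      finally show ?thesis using bounds by simp
    qed
  qed
qed

text \<open>On the unit sphere of risky positions the objective for payoff zero and initial position zero is
  bounded below by some \<open>\<epsilon> > 0\<close>, also for prices near the secure price \<open>s0\<close>. Superhomogeneity turns
  this into linear growth. A nonnegative payoff only increases the worst-case cost, and another
  initial position lowers the objective at most by a locally bounded amount.\<close>

lemma objective_coercive:
  assumes t: "t < T" and g: "\<And>s. 0 \<le> g s"
    and zero: "lsc (\<lambda>(s, y). val (Suc t) (\<lambda>_. 0) s y)"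
    and s0: "s0 \<in> secure t"
  shows "coercive_at (\<lambda>((s, v), y). objective t (val (Suc t) g) s v y) (risky_space k) (s0, v0)"
  unfolding coercive_at_def
proof
  fix c :: real
  let ?L = "\<lambda>((s, v), y). objective t (val (Suc t) g) s v y"
  let ?K = "risky_space k \<inter> sphere 0 1"
  let ?D = "\<lambda>s y. objective t (val (Suc t) (\<lambda>_. 0)) s 0 y"
  have lsc_D: "lsc (\<lambda>(s, y). ?D s y)" by (rule lsc_objective_from_0[OF t zero])
  have "\<exists>\<epsilon>>0. \<forall>y\<in>?K. ereal \<epsilon> < ?D s0 y"
  proof (cases "?K = {}")
    case True
    then show ?thesis by (intro exI[of _ 1]) auto
  next
    case False
    have "continuous_on UNIV (\<lambda>y. (s0, y))" by (intro continuous_intros)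
    from lsc_compose[OF lsc_D this] have "lsc (?D s0)" by simp
    from lsc_attains_Inf[OF this compact_risky_sphere False]
    obtain y0 where y0: "y0 \<in> ?K" "\<And>y. y \<in> ?K \<Longrightarrow> ?D s0 y0 \<le> ?D s0 y" by blast
    from s0 y0(1) have "0 < ?D s0 y0" by (simp add: secure_prices_def)
    then obtain \<epsilon> where "0 < ereal \<epsilon>" "ereal \<epsilon> < ?D s0 y0" using ereal_dense2 by blast
    with y0(2) show ?thesis by (intro exI[of _ \<epsilon>]) (auto intro: less_le_trans)
  qed
  then obtain \<epsilon> where \<epsilon>: "0 < \<epsilon>" "\<And>y. y \<in> ?K \<Longrightarrow> ereal \<epsilon> < ?D s0 y" by blast
  have "\<forall>\<^sub>F s in nhds s0. \<forall>y\<in>?K. ereal \<epsilon> < (case (s, y) of (s, y) \<Rightarrow> ?D s y)"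
    using \<epsilon>(2) by (intro eventually_less_Inf_compact[OF lsc_D compact_risky_sphere]) simp
  then have "\<forall>\<^sub>F s in nhds s0. \<forall>y\<in>?K. ereal \<epsilon> < ?D s y" by simp
  then have ev_D: "\<forall>\<^sub>F q in nhds (s0, v0). \<forall>y\<in>?K. ereal \<epsilon> < ?D (fst q) y"
    by (rule eventually_compose_filterlim) (auto intro: filterlim_ident tendsto_fst[where a = "(s0, v0)", simplified])
  obtain h where h: "continuous_on UNIV h"
      "\<And>s v y. C t (pos_part s) (risky k y) - h (s, v) \<le> C t (pos_part s) (risky k (y - v))"
    using cost_shift[OF less_imp_le[OF t]] by blast
  have "open {q. h q < h (s0, v0) + 1}"
    by (intro open_Collect_less continuous_intros h(1))
  from eventually_nhds_in_open[OF this, of "(s0, v0)"]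
  have ev_h: "\<forall>\<^sub>F q in nhds (s0, v0). h q < h (s0, v0) + 1" by simp
  define b where "b = h (s0, v0) + 1"
  \<comment> \<open>The growth \<open>norm y * \<epsilon>\<close> must beat the level \<open>c\<close> and the shift \<open>b\<close>; scaling needs \<open>1 \<le> norm y\<close>.\<close>
  let ?r = "max 1 ((c + b) / \<epsilon>)"
  have "\<forall>\<^sub>F q in nhds (s0, v0). \<forall>y\<in>risky_space k - cball 0 ?r.
      ereal c < ?L (q, y)"
    using ev_D ev_h
  proof eventually_elim
    case (elim q)
    obtain s v where q: "q = (s, v)" by fastforce
    have "ereal c < objective t (val (Suc t) g) s v y" if y: "y \<in> risky_space k" "?r < norm y" for y
    proof -
      let ?u = "(1 / norm y) *\<^sub>R y"
      from y(2) have n: "1 \<le> norm y" "(c + b) / \<epsilon> < norm y" by auto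
      then have "c + b < norm y * \<epsilon>" using \<epsilon>(1) by (simp add: pos_divide_less_eq)
      have u: "?u \<in> ?K" using y n by (auto simp: risky_space_def)
      have "ereal (c + b) < ereal (norm y) * ereal \<epsilon>" using \<open>c + b < norm y * \<epsilon>\<close> by simp
      also have "\<dots> \<le> ereal (norm y) * ?D s ?u"
        using elim(1) u q n(1) by (intro ereal_mult_left_mono) (auto intro: less_imp_le)
      also have "\<dots> \<le> objective t (val (Suc t) (\<lambda>_. 0)) s (norm y *\<^sub>R 0) (norm y *\<^sub>R ?u)"
        using t by (intro scale_objective scale_val_zero n(1)) auto
      also have "\<dots> = ?D s y" using n(1) by simp
      finally have large: "ereal (c + b) < ?D s y" .
      have "ereal (C t (pos_part s) (risky k y) - b) + worst_case t (val (Suc t) (\<lambda>_. 0)) s y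
          \<le> objective t (val (Suc t) g) s v y"
        unfolding objective_def
      proof (rule add_mono)
        show "ereal (C t (pos_part s) (risky k y) - b) \<le> ereal (C t (pos_part s) (risky k (y - v)))"
          using h(2)[of s y v] elim(2) q by (simp add: b_def)
        show "worst_case t (val (Suc t) (\<lambda>_. 0)) s y \<le> worst_case t (val (Suc t) g) s y"
          unfolding worst_case_def using t g by (intro SUP_mono' val_zero_le_val) auto
      qed
      moreover have "ereal c
          < ereal (C t (pos_part s) (risky k y) - b) + worst_case t (val (Suc t) (\<lambda>_. 0)) s y"
        using large unfolding objective_def
        by (cases "worst_case t (val (Suc t) (\<lambda>_. 0)) s y") auto
      ultimately show ?thesis by simp
    qed
    then show ?case by (auto simp: q not_le)
  qed
  then show "\<exists>K. compact K \<and> (\<forall>\<^sub>F q in nhds (s0, v0). \<forall>y\<in>risky_space k - K.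
      ereal c < ?L (q, y))"
    by (intro exI[of _ "cball 0 ?r"] conjI compact_cball)
qed

lemma lsc_val:
  assumes "t \<le> T" "continuous_on UNIV g" "\<And>s. 0 \<le> g s"
  shows "lsc (\<lambda>(s, v). val t g s v)"
  using assms
proof (induction arbitrary: g rule: inc_induct)
  case base
  have g: "continuous_on A (\<lambda>q. g (f q))" if "continuous_on A f" for A f
    by (rule continuous_on_compose2[OF base(1) that]) simp
  have "continuous_on UNIV
      (\<lambda>q :: (real^'m) \<times> (real^'d). (pos_part (fst q), risky k (g (fst q) - snd q)))"
    by (intro continuous_intros g)
  from lsc_compose[OF cost_lsc[OF order_refl] this]
  have "lsc (\<lambda>q :: (real^'m) \<times> (real^'d). ereal (C T (pos_part (fst q)) (risky k (g (fst q) - snd q))))"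
    by simp
  moreover have "lsc (\<lambda>q :: (real^'m) \<times> (real^'d). ereal (g (fst q) $ k))"
    by (intro lsc_continuous continuous_intros g)
  ultimately have "lsc (\<lambda>q :: (real^'m) \<times> (real^'d). ereal (g (fst q) $ k)
      + ereal (C T (pos_part (fst q)) (risky k (g (fst q) - snd q))))"
    by (intro lsc_add[where f = "\<lambda>q. g (fst q) $ k"])
  then show ?case by (simp add: val_T case_prod_unfold)
next
  case (step t)
  have zero: "lsc (\<lambda>(s, y). val (Suc t) (\<lambda>_. 0) s y)" by (rule step.IH) simp_all
  let ?L = "\<lambda>((s, v), y). objective t (val (Suc t) g) s v y"
  have "lsc (\<lambda>p. if p \<in> secure t \<times> UNIV then INF y\<in>risky_space k. ?L (p, y) else -\<infinity>)"
  proof (rule lsc_coercive_Inf)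
    show "lsc ?L" by (intro lsc_objective step.hyps step.IH step.prems)
    show "open (secure t \<times> (UNIV :: (real^'d) set))"
      by (intro open_Times open_secure step.hyps zero open_UNIV)
    show "coercive_at ?L (risky_space k) p" if "p \<in> secure t \<times> UNIV" for p
      using that by (cases p) (auto intro!: objective_coercive step.hyps step.prems zero)
  qed (rule closed_risky_space)
  also have "(\<lambda>p. if p \<in> secure t \<times> UNIV then INF y\<in>risky_space k. ?L (p, y) else -\<infinity>)
      = (\<lambda>(s, v). val t g s v)"
    by (auto simp: fun_eq_iff val_step step.hyps)
  finally show ?case .
qed

end


section \<open>Dynamic programming\<close>

context supported_market
begin

definition admissible_payoff :: "(real ^ 'm \<Rightarrow> real ^ 'd) \<Rightarrow> ('w \<Rightarrow> real ^ 'd) \<Rightarrow> bool" where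
  "admissible_payoff g \<xi> \<longleftrightarrow> \<xi> \<in> borel_measurable (F T) \<and> (AE \<omega> in M. \<xi> \<omega> = g (S T \<omega>)) \<and>
     continuous_on UNIV g \<and> (\<forall>s. 0 \<le> g s)"

lemma admissible_zero: "admissible_payoff (\<lambda>_. 0) (\<lambda>_. 0)"
  by (simp add: admissible_payoff_def)

lemma lsc_val_admissible:
  "t \<le> T \<Longrightarrow> admissible_payoff g \<xi> \<Longrightarrow> lsc (\<lambda>(s, v). val t g s v)"
  by (rule lsc_val) (auto simp: admissible_payoff_def)

lemma space_F: "t \<le> T \<Longrightarrow> space (F t) = space M"
  using subalgebra_F by (simp add: subalgebra_def)

lemma measurable_F_mono:
  assumes "X \<in> borel_measurable (F s)" "s \<le> t" "t \<le> T"
  shows "X \<in> borel_measurable (F t)"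
  using assms F_mono[OF assms(2,3)] space_F[of s] space_F[of t]
  by (intro measurable_from_subalg[of "F t" "F s" X]) (auto simp: subalgebra_def)

lemma pos_part_price: "t \<le> T \<Longrightarrow> \<omega> \<in> space M \<Longrightarrow> pos_part (S t \<omega>) = S t \<omega>"
  by (rule pos_part_eq) (rule S_nonneg)

lemma lsc_compose_measurable:
  fixes f :: "(real ^ 'm) \<Rightarrow> (real ^ 'd) \<Rightarrow> ereal"
  assumes "lsc (\<lambda>(s, y). f s y)" "X \<in> borel_measurable N" "Y \<in> borel_measurable N"
  shows "(\<lambda>\<omega>. f (X \<omega>) (Y \<omega>)) \<in> borel_measurable N"
  using measurable_compose[OF borel_measurable_Pair[OF assms(2,3)] lsc_borel_measurable[OF assms(1)]]
  by simp

lemma cost_measurable: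
  assumes "t \<le> T" "X \<in> borel_measurable (F t)"
  shows "(\<lambda>\<omega>. C t (S t \<omega>) (X \<omega>)) \<in> borel_measurable (F t)"
  using measurable_compose[OF borel_measurable_Pair[OF S_measurable[OF assms(1)] assms(2)]
      cost_borel[OF assms(1)]] by simp

lemma risky_measurable: "X \<in> borel_measurable N \<Longrightarrow> (\<lambda>\<omega>. risky k (X \<omega>)) \<in> borel_measurable N"
  using borel_measurable_continuous_onI[OF continuous_on_risky[OF continuous_on_id], of k]
  by (rule measurable_compose[rotated])

text \<open>The points \<open>s\<close> with \<open>f s (Z \<omega>) \<le> Y \<omega>\<close> form a random closed set that contains the next price, so it
  contains the conditional support. Together with the converse below, the worst case over the
  support is the conditional essential supremum.\<close>

lemma worst_case_le:
  assumes t: "t < T" and f: "lsc (\<lambda>(s, y). f s y)"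
    and Z: "Z \<in> borel_measurable (F t)" and Y: "Y \<in> borel_measurable (F t)"
    and le: "AE \<omega> in M. f (S (Suc t) \<omega>) (Z \<omega>) \<le> Y \<omega>"
  shows "AE \<omega> in M. worst_case t f (S t \<omega>) (Z \<omega>) \<le> Y \<omega>"
proof -
  have "continuous_on UNIV (\<lambda>q :: (real ^ 'd) \<times> (real ^ 'm). (snd q, fst q))"
    by (intro continuous_intros)
  from lsc_compose[OF f this]
  have "lsc (\<lambda>q :: (real ^ 'd) \<times> (real ^ 'm). f (snd q) (fst q))" by simp
  from random_closed_set_sublevel[OF this closed_UNIV Z Y]
  have "random_closed_set (F t) (\<lambda>\<omega>. {s. f s (Z \<omega>) \<le> Y \<omega>})" by simp
  moreover have "AE \<omega> in M. S (Suc t) \<omega> \<in> {s. f s (Z \<omega>) \<le> Y \<omega>}" using le by simp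
  ultimately have "AE \<omega> in M. \<phi> t (S t \<omega>) \<subseteq> {s. f s (Z \<omega>) \<le> Y \<omega>}"
    using support[OF t] unfolding is_cond_supp_def by blast
  then show ?thesis
    using AE_space
  proof eventually_elim
    case (elim \<omega>)
    then show ?case
      using t by (auto simp: worst_case_def pos_part_price intro!: SUP_least)
  qed
qed

lemma le_worst_case:
  assumes t: "t < T"
  shows "AE \<omega> in M. \<forall>y. f (S (Suc t) \<omega>) y \<le> worst_case t f (S t \<omega>) y"
proof -
  have "AE \<omega> in M. S (Suc t) \<omega> \<in> \<phi> t (S t \<omega>)"
    using support[OF t] unfolding is_cond_supp_def by blast
  then show ?thesis
    using AE_space
  proof eventually_elim
    case (elim \<omega>)
    then show ?case
      using t by (auto simp: worst_case_def pos_part_price intro: SUP_upper)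
  qed
qed

abbreviation plan_cost :: "('w \<Rightarrow> real ^ 'd) \<Rightarrow> nat \<Rightarrow> (int \<Rightarrow> 'w \<Rightarrow> real ^ 'd) \<Rightarrow> 'w \<Rightarrow> ereal" where
  "plan_cost \<equiv> strategy_cost T k S C"

abbreviation plans ::
    "('w \<Rightarrow> real ^ 'd) \<Rightarrow> nat \<Rightarrow> ('w \<Rightarrow> real ^ 'd) \<Rightarrow> (int \<Rightarrow> 'w \<Rightarrow> real ^ 'd) set" where
  "plans \<equiv> strategies F T k"

lemma plan_cost_T:
  "V \<in> plans \<xi> T v \<Longrightarrow> plan_cost \<xi> T V \<omega> = ereal (\<xi> \<omega> $ k + C T (S T \<omega>) (risky k (\<xi> \<omega> - v \<omega>)))"
  by (simp add: strategy_cost_def strategies_def risky_diff)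

lemma plan_cost_step:
  assumes "t < T"
  shows "plan_cost \<xi> t V \<omega> =
    ereal (C t (S t \<omega>) (V (int t) \<omega> - V (int t - 1) \<omega>)) + plan_cost \<xi> (Suc t) V \<omega>"
  using assms by (simp add: strategy_cost_def sum.atLeast_Suc_atMost)

text \<open>A plan from time \<open>t + 1\<close> on becomes one from time \<open>t\<close> by declaring the position held before trading.\<close>

lemma plan_prepend:
  fixes v Z :: "'w \<Rightarrow> real ^ 'd"
  assumes t: "t < T" and V: "V \<in> plans \<xi> (Suc t) Z" and Z: "Z \<in> borel_measurable (F t)"
    and Z_risky: "\<And>\<omega>. Z \<omega> \<in> risky_space k"
  defines "W \<equiv> V(int t - 1 := \<lambda>\<omega>. risky k (v \<omega>))"
  shows "W \<in> plans \<xi> t v"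
    and "plan_cost \<xi> t W \<omega>
      = ereal (C t (S t \<omega>) (risky k (Z \<omega> - v \<omega>))) + plan_cost \<xi> (Suc t) V \<omega>"
proof -
  have V_t: "V (int t) = Z"
    using V Z_risky by (auto simp: strategies_def risky_eq risky_space_def)
  show "W \<in> plans \<xi> t v"
    unfolding strategies_def
  proof (intro CollectI conjI allI impI)
    show "W (int t - 1) = (\<lambda>\<omega>. risky k (v \<omega>))" by (simp add: W_def)
    show "W (int T) = (\<lambda>\<omega>. risky k (\<xi> \<omega>))" using V t by (simp add: W_def strategies_def)
    fix s \<omega> assume s: "t \<le> s \<and> s < T"
    then have W_s: "W (int s) = V (int s)" by (simp add: W_def)
    show "W (int s) \<in> borel_measurable (F s)" "W (int s) \<omega> $ k = 0"
      unfolding W_s using s V V_t Z Z_risky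
      by (cases "s = t"; simp add: strategies_def risky_space_def)+
  qed
  have "plan_cost \<xi> (Suc t) W \<omega> = plan_cost \<xi> (Suc t) V \<omega>"
    unfolding strategy_cost_def W_def by (auto intro!: sum.cong)
  moreover have "W (int t) \<omega> - W (int t - 1) \<omega> = risky k (Z \<omega> - v \<omega>)"
    using V_t Z_risky by (simp add: W_def risky_diff risky_eq risky_space_def)
  ultimately show "plan_cost \<xi> t W \<omega>
      = ereal (C t (S t \<omega>) (risky k (Z \<omega> - v \<omega>))) + plan_cost \<xi> (Suc t) V \<omega>"
    using plan_cost_step[OF t, of \<xi> W \<omega>] by simp
qed

text \<open>The two halves of the claim that \<open>val\<close> is the minimal hedging cost. Both are phrased
  with measurable upper bounds of the cost instead of its essential supremum: a bound at time \<open>t\<close> minus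
  the cost of the trade at \<open>t\<close> is a bound at time \<open>t + 1\<close>, so they pass through the induction.\<close>

definition val_bounds :: "nat \<Rightarrow> bool" where
  "val_bounds t \<longleftrightarrow> (\<forall>g \<xi> v V Y. admissible_payoff g \<xi> \<longrightarrow> v \<in> borel_measurable (F t) \<longrightarrow>
     V \<in> plans \<xi> t v \<longrightarrow> Y \<in> borel_measurable (F t) \<longrightarrow> (AE \<omega> in M. plan_cost \<xi> t V \<omega> \<le> Y \<omega>) \<longrightarrow>
     (AE \<omega> in M. val t g (S t \<omega>) (v \<omega>) \<le> Y \<omega>))"

definition val_attained :: "nat \<Rightarrow> bool" where
  "val_attained t \<longleftrightarrow> (\<forall>g \<xi> v. admissible_payoff g \<xi> \<longrightarrow> v \<in> borel_measurable (F t) \<longrightarrow>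
     (\<exists>V\<in>plans \<xi> t v. AE \<omega> in M. plan_cost \<xi> t V \<omega> \<le> val t g (S t \<omega>) (v \<omega>)))"

lemma val_boundsD:
  assumes "val_bounds t" "admissible_payoff g \<xi>" "v \<in> borel_measurable (F t)"
    "V \<in> plans \<xi> t v" "Y \<in> borel_measurable (F t)" "AE \<omega> in M. plan_cost \<xi> t V \<omega> \<le> Y \<omega>"
  shows "AE \<omega> in M. val t g (S t \<omega>) (v \<omega>) \<le> Y \<omega>"
  using assms(1)[unfolded val_bounds_def, rule_format, OF assms(2-6)] .

lemma val_attainedD:
  assumes "val_attained t" "admissible_payoff g \<xi>" "v \<in> borel_measurable (F t)"
  shows "\<exists>V\<in>plans \<xi> t v. AE \<omega> in M. plan_cost \<xi> t V \<omega> \<le> val t g (S t \<omega>) (v \<omega>)"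
  using assms(1)[unfolded val_attained_def, rule_format, OF assms(2-3)] .

lemma val_T_eq_cost:
  assumes "admissible_payoff g \<xi>" "V \<in> plans \<xi> T v"
  shows "AE \<omega> in M. val T g (S T \<omega>) (v \<omega>) = plan_cost \<xi> T V \<omega>"
proof -
  have "AE \<omega> in M. \<xi> \<omega> = g (S T \<omega>)" using assms(1) by (simp add: admissible_payoff_def)
  then show ?thesis
    using AE_space
    by eventually_elim (simp add: plan_cost_T[OF assms(2)] val_T pos_part_price)
qed

lemma val_bounds_T: "val_bounds T"
  unfolding val_bounds_def
proof (intro allI impI)
  fix g \<xi> v V Y
  assume "admissible_payoff g \<xi>" "V \<in> plans \<xi> T v" "AE \<omega> in M. plan_cost \<xi> T V \<omega> \<le> Y \<omega>"
  with val_T_eq_cost[of g \<xi> V v] show "AE \<omega> in M. val T g (S T \<omega>) (v \<omega>) \<le> Y \<omega>"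
    by (auto elim: eventually_elim2)
qed

lemma val_attained_T: "val_attained T"
  unfolding val_attained_def
proof (intro allI impI)
  fix g \<xi> and v :: "'w \<Rightarrow> real ^ 'd" assume \<xi>: "admissible_payoff g \<xi>"
  let ?V = "(\<lambda>_ \<omega>. risky k (v \<omega>))(int T := \<lambda>\<omega>. risky k (\<xi> \<omega>))"
  have V: "?V \<in> plans \<xi> T v" by (auto simp: strategies_def)
  from val_T_eq_cost[OF \<xi> V]
  have "AE \<omega> in M. plan_cost \<xi> T ?V \<omega> \<le> val T g (S T \<omega>) (v \<omega>)"
    by eventually_elim simp
  with V show "\<exists>V\<in>plans \<xi> T v. AE \<omega> in M. plan_cost \<xi> T V \<omega> \<le> val T g (S T \<omega>) (v \<omega>)"
    by blast
qed

lemma val_bounds_step: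
  assumes t: "t < T" and secure: "AE \<omega> in M. S t \<omega> \<in> secure t" and IH: "val_bounds (Suc t)"
  shows "val_bounds t"
  unfolding val_bounds_def
proof (intro allI impI)
  fix g \<xi> v V Y
  assume \<xi>: "admissible_payoff g \<xi>" and v: "v \<in> borel_measurable (F t)"
    and V: "V \<in> plans \<xi> t v" and Y: "Y \<in> borel_measurable (F t)"
    and le: "AE \<omega> in M. plan_cost \<xi> t V \<omega> \<le> Y \<omega>"
  have t': "t \<le> T" "Suc t \<le> T" using t by auto
  let ?Z = "V (int t)"
  have Z: "?Z \<in> borel_measurable (F t)" "\<And>\<omega>. ?Z \<omega> \<in> risky_space k"
    and V0: "V (int t - 1) = (\<lambda>\<omega>. risky k (v \<omega>))"
    using V t by (auto simp: strategies_def risky_space_def)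
  have V': "V \<in> plans \<xi> (Suc t) ?Z"
    using V t Z(2) by (auto simp: strategies_def risky_eq risky_space_def)
  let ?c = "\<lambda>\<omega>. C t (S t \<omega>) (risky k (?Z \<omega> - v \<omega>))"
  let ?Y = "\<lambda>\<omega>. Y \<omega> - ereal (?c \<omega>)"
  have "?c \<in> borel_measurable (F t)"
    using t' v Z(1) by (intro cost_measurable risky_measurable borel_measurable_diff)
  then have Y': "?Y \<in> borel_measurable (F t)"
    using Y by (intro borel_measurable_ereal_diff borel_measurable_ereal)
  have step: "plan_cost \<xi> t V \<omega> = ereal (?c \<omega>) + plan_cost \<xi> (Suc t) V \<omega>" for \<omega>
    using plan_cost_step[OF t, of \<xi> V \<omega>] V0 Z(2)[of \<omega>]
    by (simp add: risky_diff risky_eq risky_space_def)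
  from le have "AE \<omega> in M. plan_cost \<xi> (Suc t) V \<omega> \<le> ?Y \<omega>"
  proof eventually_elim
    case (elim \<omega>)
    then show ?case by (simp add: step ereal_le_minus add.commute)
  qed
  then have "AE \<omega> in M. val (Suc t) g (S (Suc t) \<omega>) (?Z \<omega>) \<le> ?Y \<omega>"
    by (rule val_boundsD[OF IH \<xi> measurable_F_mono[OF Z(1) le_SucI[OF order_refl] t'(2)] V'
          measurable_F_mono[OF Y' le_SucI[OF order_refl] t'(2)]])
  from worst_case_le[OF t lsc_val_admissible[OF t'(2) \<xi>] Z(1) Y' this] secure AE_space
  show "AE \<omega> in M. val t g (S t \<omega>) (v \<omega>) \<le> Y \<omega>"
  proof eventually_elim
    case (elim \<omega>)
    have "val t g (S t \<omega>) (v \<omega>) \<le> objective t (val (Suc t) g) (S t \<omega>) (v \<omega>) (?Z \<omega>)"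
      using elim(2) Z(2) by (simp add: val_step[OF t] INF_lower)
    also have "\<dots> = ereal (?c \<omega>) + worst_case t (val (Suc t) g) (S t \<omega>) (?Z \<omega>)"
      using t' elim(3) by (simp add: objective_def pos_part_price)
    also have "\<dots> \<le> Y \<omega>"
      using elim(1) by (simp add: ereal_le_minus add.commute)
    finally show ?case .
  qed
qed

text \<open>A measurable selection of a minimal position at time \<open>t\<close>, followed by an optimal plan from there.\<close>

lemma val_attained_step:
  assumes t: "t < T" and secure: "AE \<omega> in M. S t \<omega> \<in> secure t" and IH: "val_attained (Suc t)"
  shows "val_attained t"
  unfolding val_attained_def
proof (intro allI impI)
  fix g \<xi> and v :: "'w \<Rightarrow> real ^ 'd"
  assume \<xi>: "admissible_payoff g \<xi>" and v: "v \<in> borel_measurable (F t)"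
  have t': "t \<le> T" "Suc t \<le> T" using t by auto
  have g: "\<And>s. 0 \<le> g s" using \<xi> by (simp add: admissible_payoff_def)
  have zero: "lsc (\<lambda>(s, y). val (Suc t) (\<lambda>_. 0) s y)"
    by (rule lsc_val_admissible[OF t'(2) admissible_zero])
  let ?L = "\<lambda>((s, v), y). objective t (val (Suc t) g) s v y"
  have lsc_L: "lsc ?L" by (intro lsc_objective t lsc_val_admissible[OF t'(2) \<xi>])
  \<comment> \<open>Off the secure prices the bound is infinite, so that a selection exists for every \<open>\<omega>\<close>.\<close>
  define m where "m \<omega> = (if S t \<omega> \<in> secure t then val t g (S t \<omega>) (v \<omega>) else \<infinity>)" for \<omega>
  have "{\<omega> \<in> space (F t). S t \<omega> \<in> secure t} \<in> sets (F t)"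
    using measurable_sets[OF S_measurable[OF t'(1)], of "secure t"] open_secure[OF t zero]
    by (simp add: vimage_def Int_def conj_commute)
  moreover have "(\<lambda>\<omega>. val t g (S t \<omega>) (v \<omega>)) \<in> borel_measurable (F t)"
    using t' v by (intro lsc_compose_measurable lsc_val_admissible[OF _ \<xi>] S_measurable)
  ultimately have m: "m \<in> borel_measurable (F t)"
    unfolding m_def by (intro measurable_If) auto
  have "\<exists>y\<in>risky_space k. ?L ((S t \<omega>, v \<omega>), y) \<le> m \<omega>" for \<omega>
  proof (cases "S t \<omega> \<in> secure t")
    case True
    have "0 \<in> risky_space k" by (simp add: risky_space_def)
    then have "risky_space k \<noteq> {}" by blast
    from coercive_Inf_attained[OF lsc_L closed_risky_space this
        objective_coercive[where ?v0.0 = "v \<omega>", OF t g zero True]]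
    show ?thesis using True by (force simp: m_def val_step[OF t])
  next
    case False
    then show ?thesis by (auto simp: m_def risky_space_def intro: exI[of _ 0])
  qed
  from measurable_selection_sublevel[OF lsc_L closed_risky_space
      borel_measurable_Pair[OF S_measurable[OF t'(1)] v] m this]
  obtain Z0 where Z0: "Z0 \<in> borel_measurable (F t)"
      "\<And>\<omega>. \<omega> \<in> space (F t) \<Longrightarrow>
        Z0 \<omega> \<in> risky_space k \<and> ?L ((S t \<omega>, v \<omega>), Z0 \<omega>) \<le> m \<omega>"
    by blast
  define Z where "Z \<omega> = risky k (Z0 \<omega>)" for \<omega>
  have Z: "Z \<in> borel_measurable (F t)" "\<And>\<omega>. Z \<omega> \<in> risky_space k"
    unfolding Z_def using risky_measurable[OF Z0(1)] by (auto simp: risky_space_def risky_nth)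
  have Z_min: "objective t (val (Suc t) g) (S t \<omega>) (v \<omega>) (Z \<omega>) \<le> m \<omega>" if "\<omega> \<in> space M" for \<omega>
    using Z0(2)[of \<omega>] that t' by (simp add: Z_def objective_risky[OF t] space_F)
  have "Z \<in> borel_measurable (F (Suc t))"
    by (rule measurable_F_mono[OF Z(1) le_SucI[OF order_refl] t'(2)])
  from val_attainedD[OF IH \<xi> this]
  obtain V where V: "V \<in> plans \<xi> (Suc t) Z"
      "AE \<omega> in M. plan_cost \<xi> (Suc t) V \<omega> \<le> val (Suc t) g (S (Suc t) \<omega>) (Z \<omega>)" ..
  let ?W = "V(int t - 1 := \<lambda>\<omega>. risky k (v \<omega>))"
  note W = plan_prepend[where v = v, OF t V(1) Z]
  from V(2) le_worst_case[OF t, of "val (Suc t) g"] secure AE_space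
  have "AE \<omega> in M. plan_cost \<xi> t ?W \<omega> \<le> val t g (S t \<omega>) (v \<omega>)"
  proof eventually_elim
    case (elim \<omega>)
    have "plan_cost \<xi> t ?W \<omega>
        \<le> ereal (C t (S t \<omega>) (risky k (Z \<omega> - v \<omega>))) + worst_case t (val (Suc t) g) (S t \<omega>) (Z \<omega>)"
      unfolding W(2) using elim(1,2) by (intro add_left_mono) (auto intro: order_trans)
    also have "\<dots> = objective t (val (Suc t) g) (S t \<omega>) (v \<omega>) (Z \<omega>)"
      using t' elim(4) by (simp add: objective_def pos_part_price)
    also have "\<dots> \<le> m \<omega>" by (rule Z_min[OF elim(4)])
    also have "\<dots> = val t g (S t \<omega>) (v \<omega>)" using elim(3) by (simp add: m_def)
    finally show ?case .
  qed
  with W(1) show "\<exists>V\<in>plans \<xi> t v. AE \<omega> in M. plan_cost \<xi> t V \<omega> \<le> val t g (S t \<omega>) (v \<omega>)"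
    by (intro bexI[of _ ?W])
qed

lemma hedging_cost_le:
  assumes t: "t \<le> T" and V: "V \<in> plans \<xi> t v" and Y: "Y \<in> borel_measurable (F t)"
    and le: "AE \<omega> in M. plan_cost \<xi> t V \<omega> \<le> Y \<omega>"
  shows "AE \<omega> in M. ess_sup M (F t) {plan_cost \<xi> t V} \<omega> \<le> Y \<omega>"
    and "AE \<omega> in M. hedging_cost M F T k S C \<xi> t v \<omega> \<le> ess_sup M (F t) {plan_cost \<xi> t V} \<omega>"
proof -
  show "AE \<omega> in M. ess_sup M (F t) {plan_cost \<xi> t V} \<omega> \<le> Y \<omega>"
    using is_ess_sup_ess_sup[OF subalgebra_F[OF t], of "{plan_cost \<xi> t V}"] Y le
    unfolding is_ess_sup_def by blast
  show "AE \<omega> in M. hedging_cost M F T k S C \<xi> t v \<omega> \<le> ess_sup M (F t) {plan_cost \<xi> t V} \<omega>"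
    using is_ess_inf_ess_inf[OF subalgebra_F[OF t],
        of "(\<lambda>V. ess_sup M (F t) {plan_cost \<xi> t V}) ` plans \<xi> t v"] V
    unfolding is_ess_inf_def hedging_cost_def by blast
qed

lemma hedging_cost_attained:
  assumes t: "t \<le> T" and bounds: "val_bounds t" and attained: "val_attained t"
    and \<xi>: "admissible_payoff g \<xi>" and v: "v \<in> borel_measurable (F t)"
  shows "AE \<omega> in M. hedging_cost M F T k S C \<xi> t v \<omega> = val t g (S t \<omega>) (v \<omega>)"
    and "\<exists>V\<in>plans \<xi> t v. AE \<omega> in M.
      ess_sup M (F t) {plan_cost \<xi> t V} \<omega> = hedging_cost M F T k S C \<xi> t v \<omega>"
proof -
  let ?val = "\<lambda>\<omega>. val t g (S t \<omega>) (v \<omega>)"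
  have val: "?val \<in> borel_measurable (F t)"
    by (intro lsc_compose_measurable lsc_val_admissible[OF t \<xi>] S_measurable[OF t] v)
  have "AE \<omega> in M. ?val \<omega> \<le> ess_sup M (F t) {plan_cost \<xi> t V} \<omega>" if "V \<in> plans \<xi> t v" for V
    using is_ess_sup_ess_sup[OF subalgebra_F[OF t], of "{plan_cost \<xi> t V}"]
    by (intro val_boundsD[OF bounds \<xi> v that]) (simp_all add: is_ess_sup_def)
  then have below: "\<forall>X\<in>(\<lambda>V. ess_sup M (F t) {plan_cost \<xi> t V}) ` plans \<xi> t v.
      AE \<omega> in M. ?val \<omega> \<le> X \<omega>"
    by simp
  have "is_ess_inf M (F t) ((\<lambda>V. ess_sup M (F t) {plan_cost \<xi> t V}) ` plans \<xi> t v)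
      (hedging_cost M F T k S C \<xi> t v)"
    unfolding hedging_cost_def by (rule is_ess_inf_ess_inf[OF subalgebra_F[OF t]])
  then have lower: "AE \<omega> in M. ?val \<omega> \<le> hedging_cost M F T k S C \<xi> t v \<omega>"
    unfolding is_ess_inf_def using val below by simp
  from val_attainedD[OF attained \<xi> v]
  obtain V where V: "V \<in> plans \<xi> t v" "AE \<omega> in M. plan_cost \<xi> t V \<omega> \<le> ?val \<omega>" ..
  note upper = hedging_cost_le[OF t V(1) val V(2)]
  from lower upper show "AE \<omega> in M. hedging_cost M F T k S C \<xi> t v \<omega> = ?val \<omega>"
    by eventually_elim auto
  from lower upper have "AE \<omega> in M.
      ess_sup M (F t) {plan_cost \<xi> t V} \<omega> = hedging_cost M F T k S C \<xi> t v \<omega>"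
    by eventually_elim auto
  with V(1) show "\<exists>V\<in>plans \<xi> t v. AE \<omega> in M.
      ess_sup M (F t) {plan_cost \<xi> t V} \<omega> = hedging_cost M F T k S C \<xi> t v \<omega>"
    by (intro bexI[of _ V])
qed


section \<open>Absence of immediate profits\<close>

text \<open>For \<open>t + 1\<close> the hedging cost is already known to be \<open>val\<close> at the next price, whose conditional
  essential supremum is the worst case over the support.\<close>

lemma theta_eq_worst_case:
  assumes t: "t < T" and bounds: "val_bounds (Suc t)" and attained: "val_attained (Suc t)"
    and \<xi>: "admissible_payoff g \<xi>" and Z: "Z \<in> borel_measurable (F t)"
  shows "AE \<omega> in M. theta M F T k S C \<xi> t Z \<omega> = worst_case t (val (Suc t) g) (S t \<omega>) (Z \<omega>)"
proof -
  have t': "t \<le> T" "Suc t \<le> T" using t by auto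
  let ?H = "hedging_cost M F T k S C \<xi> (Suc t) Z"
  let ?w = "\<lambda>\<omega>. worst_case t (val (Suc t) g) (S t \<omega>) (Z \<omega>)"
  have "is_ess_sup M (F t) {?H} (theta M F T k S C \<xi> t Z)"
    unfolding theta_def by (rule is_ess_sup_ess_sup[OF subalgebra_F[OF t'(1)]])
  then have theta: "theta M F T k S C \<xi> t Z \<in> borel_measurable (F t)"
      "AE \<omega> in M. ?H \<omega> \<le> theta M F T k S C \<xi> t Z \<omega>"
      "\<And>Y. Y \<in> borel_measurable (F t) \<Longrightarrow> AE \<omega> in M. ?H \<omega> \<le> Y \<omega>
        \<Longrightarrow> AE \<omega> in M. theta M F T k S C \<xi> t Z \<omega> \<le> Y \<omega>"
    unfolding is_ess_sup_def by auto
  have lsc_val': "lsc (\<lambda>(s, y). val (Suc t) g s y)" by (rule lsc_val_admissible[OF t'(2) \<xi>])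
  have H: "AE \<omega> in M. ?H \<omega> = val (Suc t) g (S (Suc t) \<omega>) (Z \<omega>)"
    using t' by (intro hedging_cost_attained(1) bounds attained \<xi> measurable_F_mono[OF Z]) auto
  from H theta(2) have "AE \<omega> in M. val (Suc t) g (S (Suc t) \<omega>) (Z \<omega>) \<le> theta M F T k S C \<xi> t Z \<omega>"
    by eventually_elim simp
  then have ge: "AE \<omega> in M. ?w \<omega> \<le> theta M F T k S C \<xi> t Z \<omega>"
    by (rule worst_case_le[OF t lsc_val' Z theta(1)])
  have "continuous_on UNIV (\<lambda>q :: (real ^ 'm) \<times> (real ^ 'd). (pos_part (fst q), snd q))"
    by (intro continuous_intros)
  from lsc_compose[OF lsc_Sup_hemicontinuous[OF lsc_val' hemicontinuous[OF t]] this]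
  have "lsc (\<lambda>(s, y). worst_case t (val (Suc t) g) s y)"
    by (simp add: worst_case_def case_prod_unfold)
  then have "?w \<in> borel_measurable (F t)"
    by (intro lsc_compose_measurable S_measurable[OF t'(1)] Z)
  moreover from H le_worst_case[OF t, of "val (Suc t) g"] have "AE \<omega> in M. ?H \<omega> \<le> ?w \<omega>"
    by eventually_elim simp
  ultimately have "AE \<omega> in M. theta M F T k S C \<xi> t Z \<omega> \<le> ?w \<omega>" by (rule theta(3))
  with ge show ?thesis by eventually_elim simp
qed

text \<open>Select measurably a unit risky position \<open>Z\<close> minimizing the one-step objective for payoff zero. By AIP
  its objective is nonnegative. Using \<open>Z\<close> where the objective vanishes, and no position elsewhere, costs
  exactly zero; by SAIP that position is null, so the objective of \<open>Z\<close>, and with it that of every unit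
  position, is almost surely positive.\<close>

lemma prices_secure:
  assumes t: "t < T" and bounds: "val_bounds (Suc t)" and attained: "val_attained (Suc t)"
    and saip: "SAIP_at M F T k S C t" and aip: "AIP_at M F T k S C (Suc t)"
  shows "AE \<omega> in M. S t \<omega> \<in> secure t"
proof (cases "risky_space k \<inter> sphere 0 1 = {}")
  case True
  then show ?thesis by (simp add: secure_prices_def)
next
  case ne: False
  have t': "t \<le> T" "Suc t \<le> T" using t by auto
  let ?K = "risky_space k \<inter> sphere 0 1"
  let ?val = "val (Suc t) (\<lambda>_. 0)"
  let ?D = "\<lambda>s y. objective t ?val s 0 y"
  have lsc_val': "lsc (\<lambda>(s, y). ?val s y)"
    by (rule lsc_val_admissible[OF t'(2) admissible_zero])
  have lsc_D: "lsc (\<lambda>(s, y). ?D s y)" by (rule lsc_objective_from_0[OF t lsc_val'])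
  have D_eq: "?D (S t \<omega>) y = ereal (C t (S t \<omega>) (risky k y)) + worst_case t ?val (S t \<omega>) y"
    if "\<omega> \<in> space M" for \<omega> y
    using that t' by (simp add: objective_def pos_part_price)
  have closed_K: "closed ?K" by (rule compact_imp_closed[OF compact_risky_sphere])
  have coercive: "coercive_at (\<lambda>(s, y). ?D s y) ?K s" for s
    unfolding coercive_at_def using compact_risky_sphere by (intro allI exI[of _ ?K]) auto
  let ?m = "\<lambda>s. INF y\<in>?K. (case (s, y) of (s, y) \<Rightarrow> ?D s y)"
  have "lsc ?m"
    using lsc_coercive_Inf[OF lsc_D closed_K open_UNIV coercive] by simp
  then have m: "(\<lambda>\<omega>. ?m (S t \<omega>)) \<in> borel_measurable (F t)"
    by (rule measurable_compose[OF S_measurable[OF t'(1)] lsc_borel_measurable])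
  have "\<exists>y\<in>?K. (case (S t \<omega>, y) of (s, y) \<Rightarrow> ?D s y) \<le> ?m (S t \<omega>)" for \<omega>
    using coercive_Inf_attained[OF lsc_D closed_K ne coercive, of "S t \<omega>"] by (metis order_refl)
  from measurable_selection_sublevel[OF lsc_D closed_K S_measurable[OF t'(1)] m this]
  obtain Z0 where Z0: "Z0 \<in> borel_measurable (F t)"
      "\<And>\<omega>. \<omega> \<in> space (F t) \<Longrightarrow>
        Z0 \<omega> \<in> ?K \<and> (case (S t \<omega>, Z0 \<omega>) of (s, y) \<Rightarrow> ?D s y) \<le> ?m (S t \<omega>)"
    by blast
  have Z0_K: "Z0 \<omega> \<in> ?K" if "\<omega> \<in> space M" for \<omega>
    using Z0(2) that t' by (simp add: space_F)
  have Z0_min: "?D (S t \<omega>) (Z0 \<omega>) \<le> ?D (S t \<omega>) y" if "\<omega> \<in> space M" "y \<in> ?K" for \<omega> y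
  proof -
    have "?D (S t \<omega>) (Z0 \<omega>) \<le> ?m (S t \<omega>)" using Z0(2)[of \<omega>] that t' by (simp add: space_F)
    also have "\<dots> \<le> ?D (S t \<omega>) y" using INF_lower[OF that(2)] by simp
    finally show ?thesis .
  qed
  define Z where "Z \<omega> = risky k (Z0 \<omega>)" for \<omega>
  have Z: "Z \<in> borel_measurable (F t)" "\<And>\<omega>. Z \<omega> \<in> risky_space k"
    unfolding Z_def using risky_measurable[OF Z0(1)] by (auto simp: risky_space_def risky_nth)
  have Z_eq: "Z \<omega> = Z0 \<omega>" if "\<omega> \<in> space M" for \<omega>
    using Z0_K[OF that] by (simp add: Z_def risky_space_def risky_eq)
  have D_measurable: "(\<lambda>\<omega>. ?D (S t \<omega>) (X \<omega>)) \<in> borel_measurable (F t)"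
    if "X \<in> borel_measurable (F t)" for X
    using that by (intro lsc_compose_measurable[OF lsc_D] S_measurable[OF t'(1)])

  have D_nonneg: "AE \<omega> in M. 0 \<le> ?D (S t \<omega>) (Z \<omega>)"
  proof -
    have "Z \<in> borel_measurable (F (Suc t))"
      by (rule measurable_F_mono[OF Z(1) le_SucI[OF order_refl] t'(2)])
    from val_attainedD[OF attained admissible_zero this]
    obtain V where V: "V \<in> plans (\<lambda>_. 0) (Suc t) Z"
        "AE \<omega> in M. plan_cost (\<lambda>_. 0) (Suc t) V \<omega> \<le> ?val (S (Suc t) \<omega>) (Z \<omega>)" ..
    let ?W = "V(int t - 1 := \<lambda>\<omega>. risky k 0)"
    note W = plan_prepend[where v = "\<lambda>_. 0", OF t V(1) Z]
    from V(2) le_worst_case[OF t, of ?val] AE_space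
    have "AE \<omega> in M. plan_cost (\<lambda>_. 0) t ?W \<omega> \<le> ?D (S t \<omega>) (Z \<omega>)"
    proof eventually_elim
      case (elim \<omega>)
      then show ?case
        unfolding W(2) D_eq[OF elim(3)] diff_zero by (intro add_left_mono) (auto intro: order_trans)
    qed
    note * = hedging_cost_le[OF t'(1) W(1) D_measurable[OF Z(1)] this]
    have "AE \<omega> in M. hedging_cost M F T k S C (\<lambda>_. 0) t (\<lambda>_. 0) \<omega> = 0"
      using saip by (simp add: SAIP_at_def AIP_at_def)
    with * show ?thesis by eventually_elim auto
  qed

  have D_0: "AE \<omega> in M. ?D (S t \<omega>) 0 = 0"
  proof -
    have zero_measurable: "(\<lambda>_. 0 :: real ^ 'd) \<in> borel_measurable (F (Suc t))" by simp
    have val_0: "AE \<omega> in M. ?val (S (Suc t) \<omega>) 0 = 0"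
      using hedging_cost_attained(1)[OF t'(2) bounds attained admissible_zero zero_measurable] aip
      unfolding AIP_at_def by (auto elim: eventually_elim2)
    then have "AE \<omega> in M. ?val (S (Suc t) \<omega>) 0 \<le> 0" by eventually_elim simp
    then have "AE \<omega> in M. worst_case t ?val (S t \<omega>) 0 \<le> 0"
      using worst_case_le[OF t lsc_val', of "\<lambda>_. 0" "\<lambda>_. 0"] by simp
    with val_0 le_worst_case[OF t, of ?val] AE_space show ?thesis
    proof eventually_elim
      case (elim \<omega>)
      then have "0 \<le> worst_case t ?val (S t \<omega>) 0" by metis
      with elim show ?case
        using t' by (simp add: D_eq risky_0 cost_zero S_nonneg zero_ereal_def[symmetric])
    qed
  qed

  define Z' where "Z' \<omega> = (if ?D (S t \<omega>) (Z \<omega>) \<le> 0 then Z \<omega> else 0)" for \<omega>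
  have Z': "Z' \<in> borel_measurable (F t)"
    unfolding Z'_def using Z(1) D_measurable[OF Z(1)]
    by (intro measurable_If borel_measurable_le) auto
  have "AE \<omega> in M. one_step_cost M F T k S C (\<lambda>_. 0) t (\<lambda>_. 0) Z' \<omega> = 0"
    using theta_eq_worst_case[OF t bounds attained admissible_zero Z'] D_nonneg D_0 AE_space
  proof eventually_elim
    case (elim \<omega>)
    have "one_step_cost M F T k S C (\<lambda>_. 0) t (\<lambda>_. 0) Z' \<omega> = ?D (S t \<omega>) (Z' \<omega>)"
      using elim(1,4) by (simp add: one_step_cost_def D_eq)
    also have "\<dots> = 0" using elim(2,3) by (auto simp: Z'_def)
    finally show ?case .
  qed
  with saip t Z' have "AE \<omega> in M. risky k (Z' \<omega>) = 0" by (simp add: SAIP_at_def)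
  then show ?thesis
    using AE_space
  proof eventually_elim
    case (elim \<omega>)
    have "0 < ?D (S t \<omega>) (Z \<omega>)"
    proof (rule ccontr)
      assume "\<not> ?thesis"
      then have "risky k (Z \<omega>) = 0" using elim(1) by (simp add: Z'_def not_less)
      moreover have "risky k (Z \<omega>) = Z \<omega>" by (simp add: Z_def risky_risky)
      ultimately show False using Z0_K[OF elim(2)] Z_eq[OF elim(2)] by simp
    qed
    then show ?case
      using Z0_min[OF elim(2)] Z_eq[OF elim(2)]
      by (auto simp: secure_prices_def intro: less_le_trans)
  qed
qed

lemma val_bounds_attained:
  assumes saip: "SAIP M F T k S C" and "t \<le> T"
  shows "val_bounds t \<and> val_attained t"
  using assms(2)
proof (induction rule: inc_induct)
  case base
  show ?case using val_bounds_T val_attained_T by blast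
next
  case (step t)
  have "AE \<omega> in M. S t \<omega> \<in> secure t"
    using step saip by (intro prices_secure) (auto simp: SAIP_def SAIP_at_def)
  with step show ?case using val_bounds_step val_attained_step by blast
qed

text \<open>The objective depends on the new position only through its risky part, so minimizing over all
  positions gives the same value.\<close>

lemma val_recursion:
  assumes saip: "SAIP M F T k S C" and t: "t < T"
  shows "AE \<omega> in M. \<forall>v. val t g (S t \<omega>) v =
    (INF y. ereal (C t (S t \<omega>) (risky k (y - v))) + (SUP s\<in>\<phi> t (S t \<omega>). val (Suc t) g s y))"
proof -
  have "AE \<omega> in M. S t \<omega> \<in> secure t"
    using t saip val_bounds_attained[OF saip, of "Suc t"]
    by (intro prices_secure) (auto simp: SAIP_def SAIP_at_def)
  then show ?thesis
    using AE_space
  proof eventually_elim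
    case (elim \<omega>)
    have "(INF y\<in>risky_space k. objective t (val (Suc t) g) (S t \<omega>) v y)
        = (INF y. objective t (val (Suc t) g) (S t \<omega>) v y)" for v
    proof (rule antisym)
      show "(INF y\<in>risky_space k. objective t (val (Suc t) g) (S t \<omega>) v y)
          \<le> (INF y. objective t (val (Suc t) g) (S t \<omega>) v y)"
      proof (rule INF_greatest)
        fix y
        have "risky k y \<in> risky_space k" by (simp add: risky_space_def risky_nth)
        from INF_lower[OF this, of "objective t (val (Suc t) g) (S t \<omega>) v"]
        show "(INF y\<in>risky_space k. objective t (val (Suc t) g) (S t \<omega>) v y)
            \<le> objective t (val (Suc t) g) (S t \<omega>) v y"
          by (simp add: objective_risky[OF t])
      qed
    qed (rule INF_superset_mono; simp)
    with elim t show ?case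
      by (simp add: val_step objective_def worst_case_def pos_part_price)
  qed
qed

end


section \<open>Existence and attainment of minimal hedging costs\<close>

text \<open>Testing superhomogeneity on the positions \<open>cash k\<close> and \<open>- cash k\<close>, whose costs are \<open>1\<close> and \<open>- 1\<close>,
  forces \<open>\<delta>\<close> to be the identity on \<open>[1, \<infinity>)\<close>.\<close>

lemma super_homogeneous_scale:
  fixes C :: "nat \<Rightarrow> real ^ 'm::finite \<Rightarrow> real ^ 'd::finite \<Rightarrow> real"
  assumes market: "cost_market M F T k S C" and hom: "super_homogeneous \<delta> T C"
    and t: "t \<le> T" and l: "1 \<le> l" and s: "0 \<le> s"
  shows "l * C t s x \<le> C t s (l *\<^sub>R x)"
proof -
  interpret cost_market M F T k S C by (rule market)
  have "\<delta> (ennreal l) \<noteq> top"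
    using hom bij_is_inj[of \<delta>] by (auto simp: super_homogeneous_def inj_eq dest: injD[of \<delta> _ top])
  then obtain r where r: "0 \<le> r" "\<delta> (ennreal l) = ennreal r"
    by (cases "\<delta> (ennreal l)") auto
  have scale: "r * C t s y \<le> C t s (l *\<^sub>R y)" for y
  proof -
    have "enn2ereal (\<delta> (ennreal l)) * ereal (C t s y) \<le> ereal (C t s (l *\<^sub>R y))"
      using hom t l s unfolding super_homogeneous_def by blast
    with r show ?thesis by (simp add: enn2ereal_ennreal)
  qed
  have cash: "C t s (a *\<^sub>R cash k) = a" for a
    using cost_cash[OF t, of s 0 a] cost_zero[OF t s] by simp
  have "r = l"
    using scale[of "1 *\<^sub>R cash k"] scale[of "(- 1) *\<^sub>R cash k"] cash[of 1] cash[of "- 1"]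
      cash[of l] cash[of "- l"]
    by simp
  with scale show ?thesis by simp
qed

theorem theorem4p15:
  fixes M :: "'w measure" and F :: "nat \<Rightarrow> 'w measure" and T :: nat
    and k :: "'d::finite"
    and S :: "nat \<Rightarrow> 'w \<Rightarrow> real ^ 'm::finite"
    and C :: "nat \<Rightarrow> real ^ 'm \<Rightarrow> real ^ 'd \<Rightarrow> real"
    and \<delta> :: "ennreal \<Rightarrow> ennreal"
    and \<xi> :: "'w \<Rightarrow> real ^ 'd"
    and g :: "real ^ 'm \<Rightarrow> real ^ 'd"
    and \<phi> :: "nat \<Rightarrow> real ^ 'm \<Rightarrow> (real ^ 'm) set"
    and R :: "nat \<Rightarrow> real ^ 'm \<Rightarrow> real"
  assumes dims: "CARD('d) \<le> CARD('m)"
    and market: "cost_market M F T k S C"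
    and payoff_measurable: "\<xi> \<in> borel_measurable (F T)"
    and payoff: "AE \<omega> in M. \<xi> \<omega> = g (S T \<omega>)"
    and g_continuous: "continuous_on UNIV g"
    and g_nonneg: "\<And>s. 0 \<le> g s"
    and payoff_hedgeable: "hedgeable M F T k S C \<xi>"
    and support: "\<And>t. t < T \<Longrightarrow> is_cond_supp M (F t) (S (Suc t)) (\<lambda>\<omega>. \<phi> t (S t \<omega>))"
    and \<phi>_hemicontinuous: "\<And>t. t < T \<Longrightarrow> lower_hemicontinuous (\<phi> t)"
    and \<phi>_compact: "\<And>t s. t < T \<Longrightarrow> compact (\<phi> t s)"
    and R_continuous: "\<And>t. t < T \<Longrightarrow> continuous_on UNIV (R t)"
    and \<phi>_bounded: "\<And>t. t < T \<Longrightarrow> AE \<omega> in M. \<phi> t (S t \<omega>) \<subseteq> cball 0 (R t (S t \<omega>))"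
    and cost_normal: "\<And>t. t \<le> T \<Longrightarrow> normal_integrand (F t) (\<lambda>\<omega> (s, x). ereal (C t s x))"
    and cost_additivity:
      "\<And>t. t \<le> T \<Longrightarrow> (\<forall>s. super_additive (C t s)) \<or> (\<forall>s. sub_additive (C t s))"
    and cost_homogeneous: "super_homogeneous \<delta> T C"
    and saip: "SAIP M F T k S C"
  shows "\<exists>\<gamma> :: nat \<Rightarrow> 'w \<Rightarrow> (real ^ 'm) \<times> (real ^ 'd) \<Rightarrow> ereal.
      (\<forall>t\<le>T. normal_integrand (F t) (\<gamma> t) \<and>
         (\<forall>v\<in>borel_measurable (F (t - 1)).
            AE \<omega> in M. hedging_cost M F T k S C \<xi> t v \<omega> = \<gamma> t \<omega> (S t \<omega>, v \<omega>))) \<and>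
      (\<forall>t<T. \<forall>v\<in>borel_measurable (F (t - 1)).
         AE \<omega> in M. \<gamma> t \<omega> (S t \<omega>, v \<omega>) =
           (INF y. ereal (C t (S t \<omega>) (risky k (y - v \<omega>)))
                   + (SUP s\<in>\<phi> t (S t \<omega>). \<gamma> (Suc t) \<omega> (s, y)))) \<and>
      (\<forall>t\<le>T. \<forall>v\<in>borel_measurable (F (t - 1)). \<exists>V\<in>strategies F T k \<xi> t v.
         AE \<omega> in M. ess_sup M (F t) {strategy_cost T k S C \<xi> t V} \<omega>
                   = hedging_cost M F T k S C \<xi> t v \<omega>)"
proof -
  interpret supported_market M F T k S C \<phi>
    using market support \<phi>_hemicontinuous cost_additivity
      super_homogeneous_scale[OF market cost_homogeneous]
    by (intro supported_market.intro supported_market_axioms.intro)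
  have \<xi>: "admissible_payoff g \<xi>"
    using payoff_measurable payoff g_continuous g_nonneg by (simp add: admissible_payoff_def)
  have v: "v \<in> borel_measurable (F t)" if "v \<in> borel_measurable (F (t - 1))" "t \<le> T"
    for t and v :: "'w \<Rightarrow> real ^ 'd"
    using measurable_F_mono[OF that(1) _ that(2)] by simp
  let ?\<gamma> = "\<lambda>t (_ :: 'w) (s, v). val t g s v"
  show ?thesis
  proof (intro exI[of _ ?\<gamma>] conjI allI ballI impI)
    fix t assume t: "t \<le> T"
    have lsc: "lsc (\<lambda>(s, v). val t g s v)" by (rule lsc_val_admissible[OF t \<xi>])
    show "normal_integrand (F t) (?\<gamma> t)"
      unfolding normal_integrand_def
      using lsc measurable_compose[OF measurable_snd lsc_borel_measurable[OF lsc], of "F t"]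
      by (simp add: case_prod_unfold)
    note bounds = conjunct1[OF val_bounds_attained[OF saip t]]
      and attained = conjunct2[OF val_bounds_attained[OF saip t]]
    fix v :: "'w \<Rightarrow> real ^ 'd" assume "v \<in> borel_measurable (F (t - 1))"
    note hedging = hedging_cost_attained[OF t bounds attained \<xi> v[OF this t]]
    show "AE \<omega> in M. hedging_cost M F T k S C \<xi> t v \<omega> = ?\<gamma> t \<omega> (S t \<omega>, v \<omega>)"
      using hedging(1) by simp
    show "\<exists>V\<in>strategies F T k \<xi> t v.
        AE \<omega> in M. ess_sup M (F t) {strategy_cost T k S C \<xi> t V} \<omega>
          = hedging_cost M F T k S C \<xi> t v \<omega>"
      by (rule hedging(2))
  next
    fix t and v :: "'w \<Rightarrow> real ^ 'd" assume t: "t < T"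
    show "AE \<omega> in M. ?\<gamma> t \<omega> (S t \<omega>, v \<omega>) =
        (INF y. ereal (C t (S t \<omega>) (risky k (y - v \<omega>)))
          + (SUP s\<in>\<phi> t (S t \<omega>). ?\<gamma> (Suc t) \<omega> (s, y)))"
      using val_recursion[OF saip t, of g] by eventually_elim simp
  qed
qed

end
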